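(* Let $C$ be the species of cyclic orders, made into an $\mathfrak S_2$-species by letting the non-identity element $\tau$ of $\mathfrak S_2$ reverse the direction of each cyclic order, and let $e$ be the identity of $\mathfrak S_2$. Then its $\mathfrak S_2$-cycle index series is $$Z^{\mathfrak S_2}_{C}(e)=\sum_{k=1}^{\infty}\frac{\phi(k)}{k}\ln\frac{1}{1-p_k},\qquad Z^{\mathfrak S_2}_{C}(\tau)=\sum_{k=1}^{\infty}\frac12\bigl(p_2^{k}+p_2^{k-1}p_1^{2}\bigr)+\sum_{k=0}^{\infty}p_2^{k}p_1,$$ where $\phi$ is Euler's totient function.
   Context: $C[A]$ is the set of cyclic orders on the finite set $A$ (empty if $A=\emptyset$; a single cyclic order if $|A|=1$ or $|A|=2$); a bijection $\sigma:A\to B$ acts by relabeling, and $\tau$ reverses the cyclic direction, which commutes with relabeling. For a group $\Gamma$ acting on a species $F$ in this way (by permutations $\gamma_A$ of $F[A]$ commuting with all transports $F[\sigma]$), the $\Gamma$-cycle index series is $Z^{\Gamma}_{F}(\gamma)=\sum_{n\ge0}\frac{1}{n!}\sum_{\sigma\in\mathfrak S_n}\mathrm{fix}\bigl(\gamma_{[n]}\circ F[\sigma]\bigr)\,p_1^{\sigma_1}p_2^{\sigma_2}\cdots$, where $[n]=\{1,\dots,n\}$, $\sigma_i$ is the number of $i$-cycles of $\sigma\in\mathfrak S_n$, $p_i$ are the power-sum symmetric functions, and $\mathrm{fix}$ counts fixed points in $F[[n]]$. *)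

theory Defs
  imports
    "HOL-Library.Poly_Mapping"
    "HOL-Computational_Algebra.Formal_Power_Series"
    "HOL-Combinatorics.Orbits"
    "HOL-Algebra.Sym_Groups"
    "HOL-Algebra.Group_Action"
    "HOL-Number_Theory.Totient"
begin

section \<open>Formal power series in countably many variables\<close>

text \<open>
  A monomial in the variables \<open>x\<^sub>0, x\<^sub>1, \<dots>\<close> is a finitely supported exponent function; a
  formal power series assigns a coefficient to every monomial.
\<close>

typedef 'a mps = "UNIV :: ((nat \<Rightarrow>\<^sub>0 nat) \<Rightarrow> 'a) set"
  morphisms mps_nth Abs_mps ..

lemma mps_eqI: "(\<And>m. mps_nth f m = mps_nth g m) \<Longrightarrow> f = g"
  by (metis ext mps_nth_inject)

lemma mps_nth_Abs_mps [simp]: "mps_nth (Abs_mps f) = f"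
  by (simp add: Abs_mps_inverse)

definition mon_splits :: "(nat \<Rightarrow>\<^sub>0 nat) \<Rightarrow> ((nat \<Rightarrow>\<^sub>0 nat) \<times> (nat \<Rightarrow>\<^sub>0 nat)) set" where
  "mon_splits m = {(a, b). a + b = m}"

lemma finite_mon_splits [simp]: "finite (mon_splits m)"
proof -
  let ?L = "Poly_Mapping.lookup"
  let ?B = "{f. \<forall>i. (i \<in> Poly_Mapping.keys m \<longrightarrow> f i \<in> {..Max (insert 0 (?L m ` Poly_Mapping.keys m))})
                 \<and> (i \<notin> Poly_Mapping.keys m \<longrightarrow> f i = 0)}"
  have fB: "finite ?B"
    by (rule finite_set_of_finite_funs) auto
  have le: "?L a i \<le> ?L m i" if "a + b = m" for a b i
    using that by (auto simp: lookup_add)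
  have mem: "?L a \<in> ?B" if ab: "a + b = m" for a b
  proof (clarsimp, intro conjI impI)
    fix i assume i: "i \<in> Poly_Mapping.keys m"
    have "?L m i \<le> Max (insert 0 (?L m ` Poly_Mapping.keys m))"
      by (rule Max_ge) (use i in auto)
    then show "?L a i \<le> Max (insert 0 (?L m ` Poly_Mapping.keys m))"
      using le[OF ab, of i] by linarith
  next
    fix i assume "i \<notin> Poly_Mapping.keys m"
    then have "?L m i = 0" by (simp add: in_keys_iff)
    then show "?L a i = 0" using le[OF ab, of i] by simp
  qed
  have "(\<lambda>(a, b). (?L a, ?L b)) ` mon_splits m \<subseteq> ?B \<times> ?B"
  proof (rule image_subsetI)
    fix x assume "x \<in> mon_splits m"
    then obtain a b where ab: "x = (a, b)" "a + b = m" "b + a = m"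
      by (auto simp: mon_splits_def add.commute)
    show "(\<lambda>(a, b). (?L a, ?L b)) x \<in> ?B \<times> ?B"
      unfolding ab(1) prod.case by (rule SigmaI[OF mem[OF ab(2)] mem[OF ab(3)]])
  qed
  then have "finite ((\<lambda>(a, b). (?L a, ?L b)) ` mon_splits m)"
    using fB by (meson finite_SigmaI finite_subset)
  moreover have "inj_on (\<lambda>(a, b). (?L a, ?L b)) (mon_splits m)"
    by (intro inj_onI) (clarsimp simp: poly_mapping.lookup_inject)
  ultimately show ?thesis by (rule finite_imageD)
qed

instantiation mps :: (comm_ring_1) comm_ring_1
begin

definition "0 = Abs_mps (\<lambda>_. 0)"
definition "1 = Abs_mps (\<lambda>m. if m = 0 then 1 else 0)"
definition "f + g = Abs_mps (\<lambda>m. mps_nth f m + mps_nth g m)"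
definition "f - g = Abs_mps (\<lambda>m. mps_nth f m - mps_nth g m)"
definition "- f = Abs_mps (\<lambda>m. - mps_nth f m)"
definition "f * g = Abs_mps (\<lambda>m. \<Sum>(a, b)\<in>mon_splits m. mps_nth f a * mps_nth g b)"

lemmas mps_defs = zero_mps_def one_mps_def plus_mps_def minus_mps_def uminus_mps_def
  times_mps_def

lemma mps_one_mult_aux: "(1 :: 'a mps) * f = f"
proof (rule mps_eqI)
  fix m
  have "mps_nth (1 * f) m =
      (\<Sum>x\<in>mon_splits m. if x = (0, m) then mps_nth f m else 0)"
    unfolding mps_defs by (auto intro!: sum.cong simp: mon_splits_def)
  also have "\<dots> = mps_nth f m"
    by (simp add: sum.delta[OF finite_mon_splits]) (simp add: mon_splits_def)
  finally show "mps_nth (1 * f) m = mps_nth f m" .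
qed

instance
proof
  fix a b c :: "'a mps"
  show "a * b = b * a"
  proof (rule mps_eqI)
    fix m
    show "mps_nth (a * b) m = mps_nth (b * a) m"
      unfolding mps_defs mps_nth_Abs_mps
      by (rule sum.reindex_bij_witness[of _ "\<lambda>(x, y). (y, x)" "\<lambda>(x, y). (y, x)"])
         (auto simp: mon_splits_def ac_simps)
  qed
  show "1 * a = a" by (rule mps_one_mult_aux)
  show "a * b * c = a * (b * c)"
  proof (rule mps_eqI)
    fix m
    let ?f = "mps_nth a" and ?g = "mps_nth b" and ?h = "mps_nth c"
    have "mps_nth (a * b * c) m =
        (\<Sum>p\<in>mon_splits m. \<Sum>q\<in>mon_splits (fst p). ?f (fst q) * ?g (snd q) * ?h (snd p))"
      by (simp add: times_mps_def sum_distrib_right split_def)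
    also have "\<dots> = (\<Sum>(p, q)\<in>Sigma (mon_splits m) (\<lambda>p. mon_splits (fst p)).
        ?f (fst q) * ?g (snd q) * ?h (snd p))"
      by (subst sum.Sigma) auto
    also have "\<dots> = (\<Sum>(p, q)\<in>Sigma (mon_splits m) (\<lambda>p. mon_splits (snd p)).
        ?f (fst p) * (?g (fst q) * ?h (snd q)))"
      by (rule sum.reindex_bij_witness
          [of _ "\<lambda>((x, y), (u, v)). ((x + u, v), (x, u))" "\<lambda>((x, y), (u, v)). ((u, v + y), (v, y))"])
         (auto simp: mon_splits_def ac_simps)
    also have "\<dots> = (\<Sum>p\<in>mon_splits m. \<Sum>q\<in>mon_splits (snd p). ?f (fst p) * (?g (fst q) * ?h (snd q)))"
      by (subst sum.Sigma) auto
    also have "\<dots> = mps_nth (a * (b * c)) m"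
      by (simp add: times_mps_def sum_distrib_left split_def)
    finally show "mps_nth (a * b * c) m = mps_nth (a * (b * c)) m" .
  qed
  show "(a + b) * c = a * c + b * c"
    by (rule mps_eqI) (simp add: mps_defs split_def sum.distrib algebra_simps)
  show "(0 :: 'a mps) \<noteq> 1"
  proof
    assume "(0 :: 'a mps) = 1"
    then have "mps_nth (0 :: 'a mps) 0 = mps_nth 1 0" by simp
    then show False by (simp add: mps_defs)
  qed
qed (auto intro!: mps_eqI simp: mps_defs)

end

lemma mps_nth_zero [simp]: "mps_nth 0 m = 0"
  and mps_nth_one: "mps_nth 1 m = (if m = 0 then 1 else 0)"
  and mps_nth_add [simp]: "mps_nth (f + g) m = mps_nth f m + mps_nth g m"
  and mps_nth_diff [simp]: "mps_nth (f - g) m = mps_nth f m - mps_nth g m"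
  and mps_nth_uminus [simp]: "mps_nth (- f) m = - mps_nth f m"
  and mps_nth_mult: "mps_nth (f * g) m = (\<Sum>(a, b)\<in>mon_splits m. mps_nth f a * mps_nth g b)"
  by (simp_all add: mps_defs)

lemma mps_nth_sum [simp]: "mps_nth (sum f I) m = (\<Sum>i\<in>I. mps_nth (f i) m)"
  by (induction I rule: infinite_finite_induct) auto

definition mps_const :: "'a::comm_ring_1 \<Rightarrow> 'a mps" where
  "mps_const c = Abs_mps (\<lambda>m. if m = 0 then c else 0)"

lemma mps_nth_const_mult [simp]: "mps_nth (mps_const c * f) m = c * mps_nth f m"
proof -
  have "mps_nth (mps_const c * f) m =
      (\<Sum>x\<in>mon_splits m. if x = (0, m) then c * mps_nth f m else 0)"
    unfolding mps_const_def mps_nth_mult by (auto intro!: sum.cong simp: mon_splits_def)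
  also have "\<dots> = c * mps_nth f m"
    by (simp add: sum.delta[OF finite_mon_splits]) (simp add: mon_splits_def)
  finally show ?thesis .
qed

text \<open>
  The topology of coefficientwise stabilisation (the product of the discrete topologies on the
  coefficients), which gives meaning to infinite sums of series.
\<close>

instantiation mps :: (type) t2_space
begin

definition open_mps :: "'a mps set \<Rightarrow> bool" where
  "open_mps U \<longleftrightarrow>
     (\<forall>f\<in>U. \<exists>M. finite M \<and> (\<forall>g. (\<forall>m\<in>M. mps_nth g m = mps_nth f m) \<longrightarrow> g \<in> U))"

instance
proof
  show "open (UNIV :: 'a mps set)" by (auto simp: open_mps_def)
next
  fix S T :: "'a mps set"
  assume S: "open S" and T: "open T"
  show "open (S \<inter> T)"
    unfolding open_mps_def
  proof
    fix f assume f: "f \<in> S \<inter> T"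
    obtain M where "finite M" "\<forall>g. (\<forall>m\<in>M. mps_nth g m = mps_nth f m) \<longrightarrow> g \<in> S"
      using bspec[OF S[unfolded open_mps_def], of f] f by auto
    moreover obtain N where "finite N" "\<forall>g. (\<forall>m\<in>N. mps_nth g m = mps_nth f m) \<longrightarrow> g \<in> T"
      using bspec[OF T[unfolded open_mps_def], of f] f by auto
    ultimately show "\<exists>M. finite M \<and> (\<forall>g. (\<forall>m\<in>M. mps_nth g m = mps_nth f m) \<longrightarrow> g \<in> S \<inter> T)"
      by (intro exI[of _ "M \<union> N"]) auto
  qed
next
  fix K :: "'a mps set set"
  assume K: "\<forall>S\<in>K. open S"
  show "open (\<Union>K)"
    unfolding open_mps_def
  proof
    fix f assume "f \<in> \<Union>K"
    then obtain S where S: "S \<in> K" "f \<in> S" by blast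
    obtain M where "finite M" "\<forall>g. (\<forall>m\<in>M. mps_nth g m = mps_nth f m) \<longrightarrow> g \<in> S"
      using bspec[OF bspec[OF K S(1), unfolded open_mps_def] S(2)] by auto
    then show "\<exists>M. finite M \<and> (\<forall>g. (\<forall>m\<in>M. mps_nth g m = mps_nth f m) \<longrightarrow> g \<in> \<Union>K)"
      using S(1) by auto
  qed
next
  fix x y :: "'a mps"
  assume "x \<noteq> y"
  then obtain m where m: "mps_nth x m \<noteq> mps_nth y m" using mps_eqI by blast
  have op: "open {g. mps_nth g m = c}" for c :: 'a
    unfolding open_mps_def by (auto intro!: exI[of _ "{m}"])
  show "\<exists>U V. open U \<and> open V \<and> x \<in> U \<and> y \<in> V \<and> U \<inter> V = {}"
    using op m by (intro exI[of _ "{g. mps_nth g m = mps_nth x m}"]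
      exI[of _ "{g. mps_nth g m = mps_nth y m}"]) auto
qed

end

lemma tendsto_mps_iff:
  "(X \<longlongrightarrow> L) F \<longleftrightarrow> (\<forall>m. eventually (\<lambda>n. mps_nth (X n) m = mps_nth L m) F)"
proof (intro iffI allI)
  fix m assume "(X \<longlongrightarrow> L) F"
  moreover have "open {g. mps_nth g m = mps_nth L m}"
    unfolding open_mps_def by (auto intro!: exI[of _ "{m}"])
  ultimately show "eventually (\<lambda>n. mps_nth (X n) m = mps_nth L m) F"
    by (auto dest: topological_tendstoD)
next
  assume *: "\<forall>m. eventually (\<lambda>n. mps_nth (X n) m = mps_nth L m) F"
  show "(X \<longlongrightarrow> L) F"
  proof (rule topological_tendstoI)
    fix S assume "open S" "L \<in> S"
    then obtain M where M: "finite M" "\<And>g. (\<forall>m\<in>M. mps_nth g m = mps_nth L m) \<Longrightarrow> g \<in> S"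
      unfolding open_mps_def by blast
    have "eventually (\<lambda>n. \<forall>m\<in>M. mps_nth (X n) m = mps_nth L m) F"
      using M(1) * by (simp add: eventually_ball_finite)
    then show "eventually (\<lambda>n. X n \<in> S) F"
      by eventually_elim (use M(2) in blast)
  qed
qed

definition mon_deg :: "(nat \<Rightarrow>\<^sub>0 nat) \<Rightarrow> nat" where
  "mon_deg m = (\<Sum>i\<in>Poly_Mapping.keys m. Poly_Mapping.lookup m i)"

lemma mon_deg_superset:
  assumes "finite K" "Poly_Mapping.keys m \<subseteq> K"
  shows "mon_deg m = (\<Sum>i\<in>K. Poly_Mapping.lookup m i)"
  unfolding mon_deg_def by (rule sum.mono_neutral_left) (use assms in \<open>auto simp: in_keys_iff\<close>)

lemma mon_deg_add: "mon_deg (a + b) = mon_deg a + mon_deg b"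
proof -
  let ?K = "Poly_Mapping.keys a \<union> Poly_Mapping.keys b"
  have "mon_deg (a + b) = (\<Sum>i\<in>?K. Poly_Mapping.lookup (a + b) i)"
    by (rule mon_deg_superset) (use Poly_Mapping.keys_add[of a b] in auto)
  moreover have "mon_deg a = (\<Sum>i\<in>?K. Poly_Mapping.lookup a i)"
    "mon_deg b = (\<Sum>i\<in>?K. Poly_Mapping.lookup b i)"
    by (rule mon_deg_superset; auto)+
  ultimately show ?thesis by (simp add: lookup_add sum.distrib)
qed

lemma mon_deg_0 [simp]: "mon_deg 0 = 0"
  by (simp add: mon_deg_def)

lemma mon_deg_eq_0_iff: "mon_deg m = 0 \<longleftrightarrow> m = 0"
proof
  assume "mon_deg m = 0"
  then have "\<forall>i\<in>Poly_Mapping.keys m. Poly_Mapping.lookup m i = 0" by (simp add: mon_deg_def)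
  then show "m = 0" by (metis in_keys_iff lookup_zero poly_mapping_eqI)
qed simp

lemma mon_deg_single [simp]: "mon_deg (Poly_Mapping.single j k) = k"
  by (simp add: mon_deg_def)

definition mps_homogeneous :: "nat \<Rightarrow> 'a::comm_ring_1 mps \<Rightarrow> bool" where
  "mps_homogeneous d f \<longleftrightarrow> (\<forall>m. mps_nth f m \<noteq> 0 \<longrightarrow> mon_deg m = d)"

definition mps_ord_ge :: "nat \<Rightarrow> 'a::comm_ring_1 mps \<Rightarrow> bool" where
  "mps_ord_ge d f \<longleftrightarrow> (\<forall>m. mon_deg m < d \<longrightarrow> mps_nth f m = 0)"

lemma mps_homogeneous_imp_ord_ge: "mps_homogeneous d f \<Longrightarrow> mps_ord_ge d f"
  by (auto simp: mps_homogeneous_def mps_ord_ge_def)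

lemma mps_homogeneous_0 [simp]: "mps_homogeneous d 0"
  by (simp add: mps_homogeneous_def)

lemma mps_homogeneous_1 [simp]: "mps_homogeneous 0 1"
  by (auto simp: mps_homogeneous_def mps_nth_one)

lemma mps_homogeneous_const_mult:
  "mps_homogeneous d f \<Longrightarrow> mps_homogeneous d (mps_const c * f)"
  unfolding mps_homogeneous_def mps_nth_const_mult using mult_not_zero by blast

lemma mps_homogeneous_add:
  "mps_homogeneous d f \<Longrightarrow> mps_homogeneous d g \<Longrightarrow> mps_homogeneous d (f + g)"
  unfolding mps_homogeneous_def mps_nth_add by (metis add_0)

lemma mps_homogeneous_sum:
  "(\<And>i. i \<in> I \<Longrightarrow> mps_homogeneous d (f i)) \<Longrightarrow> mps_homogeneous d (sum f I)"
proof (induction I rule: infinite_finite_induct)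
  case (insert i I)
  then show ?case using mps_homogeneous_add[of d "f i" "sum f I"] by simp
qed simp_all

lemma mps_homogeneous_mult:
  assumes "mps_homogeneous d f" "mps_homogeneous e g"
  shows "mps_homogeneous (d + e) (f * g)"
  unfolding mps_homogeneous_def
proof (intro allI impI)
  fix m assume "mps_nth (f * g) m \<noteq> 0"
  then obtain a b where "a + b = m" "mps_nth f a * mps_nth g b \<noteq> 0"
    unfolding mps_nth_mult by (auto elim!: sum.not_neutral_contains_not_neutral simp: mon_splits_def)
  moreover from this have "mps_nth f a \<noteq> 0" "mps_nth g b \<noteq> 0"
    by auto
  ultimately show "mon_deg m = d + e"
    using assms by (auto simp: mps_homogeneous_def mon_deg_add)
qed

lemma mps_homogeneous_power: "mps_homogeneous d f \<Longrightarrow> mps_homogeneous (n * d) (f ^ n)"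
proof (induction n)
  case (Suc n)
  then show ?case using mps_homogeneous_mult[of d f "n * d" "f ^ n"] by simp
qed simp

lemma mps_homogeneous_prod:
  "(\<And>i. i \<in> I \<Longrightarrow> mps_homogeneous (d i) (f i)) \<Longrightarrow> mps_homogeneous (sum d I) (prod f I)"
proof (induction I rule: infinite_finite_induct)
  case (insert i I)
  then show ?case using mps_homogeneous_mult[of "d i" "f i" "sum d I" "prod f I"] by simp
qed simp_all

lemma mps_ord_ge_mult:
  assumes "mps_ord_ge d f" "mps_ord_ge e g"
  shows "mps_ord_ge (d + e) (f * g)"
  unfolding mps_ord_ge_def
proof (intro allI impI)
  fix m assume m: "mon_deg m < d + e"
  have "mps_nth f a * mps_nth g b = 0" if "a + b = m" for a b
  proof -
    have "mon_deg a < d \<or> mon_deg b < e" using m that by (auto simp: mon_deg_add)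
    then show ?thesis using assms by (auto simp: mps_ord_ge_def)
  qed
  then show "mps_nth (f * g) m = 0"
    unfolding mps_nth_mult by (auto intro!: sum.neutral simp: mon_splits_def)
qed

lemma mps_ord_ge_power: "mps_ord_ge d f \<Longrightarrow> mps_ord_ge (n * d) (f ^ n)"
proof (induction n)
  case (Suc n)
  then show ?case using mps_ord_ge_mult[of d f "n * d" "f ^ n"] by simp
qed (simp add: mps_ord_ge_def)

lemma mps_summable:
  assumes "\<And>n. mps_ord_ge n (f n)"
  shows "summable f"
proof -
  define L where "L = Abs_mps (\<lambda>m. \<Sum>n\<le>mon_deg m. mps_nth (f n) m)"
  have "f sums L"
    unfolding sums_def tendsto_mps_iff
  proof
    fix m
    show "eventually (\<lambda>n. mps_nth (sum f {..<n}) m = mps_nth L m) sequentially"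
    proof (rule eventually_sequentiallyI[of "Suc (mon_deg m)"])
      fix n assume n: "Suc (mon_deg m) \<le> n"
      have "(\<Sum>i<n. mps_nth (f i) m) = (\<Sum>i\<le>mon_deg m. mps_nth (f i) m)"
        by (rule sum.mono_neutral_right)
           (use n assms in \<open>auto simp: mps_ord_ge_def\<close>)
      then show "mps_nth (sum f {..<n}) m = mps_nth L m" by (simp add: L_def)
    qed
  qed
  then show ?thesis by (rule sums_summable)
qed

text \<open>
  Substitution of a series \<open>u\<close> without constant term into a univariate formal power series.
\<close>

definition fps_subst :: "'a::comm_ring_1 fps \<Rightarrow> 'a mps \<Rightarrow> 'a mps" where
  "fps_subst F u = suminf (\<lambda>n. mps_const (fps_nth F n) * u ^ n)"

lemma summable_fps_subst:
  assumes "mps_nth u 0 = 0"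
  shows "summable (\<lambda>n. mps_const (fps_nth F n) * u ^ n)"
proof (rule mps_summable)
  fix n
  have "mps_ord_ge 1 u" using assms by (auto simp: mps_ord_ge_def mon_deg_eq_0_iff)
  from mps_ord_ge_power[OF this, of n] show "mps_ord_ge n (mps_const (fps_nth F n) * u ^ n)"
    by (auto simp: mps_ord_ge_def)
qed

text \<open>
  The univariate series \<open>ln (1 / (1 - X))\<close>; \<^term>\<open>fps_ln 1\<close> is the Mercator series
  \<open>ln (1 + X)\<close>.
\<close>

definition fps_ln_inverse_1_minus_X :: "rat fps" where
  "fps_ln_inverse_1_minus_X = fps_ln 1 oo (inverse (1 - fps_X) - 1)"

text \<open>The power-sum symmetric functions \<open>p\<^sub>k = x\<^sub>0\<^sup>k + x\<^sub>1\<^sup>k + \<dots>\<close> (for \<open>k \<ge> 1\<close>).\<close>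

definition power_sum :: "nat \<Rightarrow> rat mps" where
  "power_sum k = Abs_mps (\<lambda>m. if \<exists>j. m = Poly_Mapping.single j k then 1 else 0)"

lemma mps_homogeneous_power_sum: "mps_homogeneous k (power_sum k)"
  by (auto simp: mps_homogeneous_def power_sum_def)

section \<open>Species with a group action and their cycle index series\<close>

definition cycle_count :: "nat set \<Rightarrow> (nat \<Rightarrow> nat) \<Rightarrow> nat \<Rightarrow> nat" where
  "cycle_count A \<sigma> i = card {c. (\<exists>x\<in>A. c = Orbits.orbit \<sigma> x) \<and> card c = i}"

text \<open>
  Species are given on the finite sets of natural numbers, which form a category equivalent to
  that of all finite sets and bijections. \<open>tr A B \<sigma>\<close> is the transport \<open>F[\<sigma>] : F[A] \<rightarrow> F[B]\<close> along
  a bijection \<open>\<sigma> : A \<rightarrow> B\<close>, and \<open>act g A\<close> is the permutation of \<open>F[A]\<close> by which \<open>g\<close> acts.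
\<close>

locale gamma_species =
  fixes \<Gamma> :: "('g, 'm) monoid_scheme"
    and F :: "nat set \<Rightarrow> 's set"
    and tr :: "nat set \<Rightarrow> nat set \<Rightarrow> (nat \<Rightarrow> nat) \<Rightarrow> 's \<Rightarrow> 's"
    and act :: "'g \<Rightarrow> nat set \<Rightarrow> 's \<Rightarrow> 's"
  assumes finite_structures: "finite A \<Longrightarrow> finite (F A)"
    and transport_in: "finite A \<Longrightarrow> bij_betw \<sigma> A B \<Longrightarrow> s \<in> F A \<Longrightarrow> tr A B \<sigma> s \<in> F B"
    and transport_cong: "finite A \<Longrightarrow> bij_betw \<sigma> A B \<Longrightarrow> (\<And>x. x \<in> A \<Longrightarrow> \<sigma> x = \<rho> x) \<Longrightarrow>
          s \<in> F A \<Longrightarrow> tr A B \<sigma> s = tr A B \<rho> s"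
    and transport_id: "finite A \<Longrightarrow> s \<in> F A \<Longrightarrow> tr A A id s = s"
    and transport_comp: "finite A \<Longrightarrow> bij_betw \<sigma> A B \<Longrightarrow> bij_betw \<rho> B D \<Longrightarrow> s \<in> F A \<Longrightarrow>
          tr A D (\<rho> \<circ> \<sigma>) s = tr B D \<rho> (tr A B \<sigma> s)"
    and action: "finite A \<Longrightarrow> group_action \<Gamma> (F A) (\<lambda>g. act g A)"
    and action_transport: "finite A \<Longrightarrow> bij_betw \<sigma> A B \<Longrightarrow> g \<in> carrier \<Gamma> \<Longrightarrow> s \<in> F A \<Longrightarrow>
          act g B (tr A B \<sigma> s) = tr A B \<sigma> (act g A s)"

definition fix_count :: "'s set \<Rightarrow> ('s \<Rightarrow> 's) \<Rightarrow> nat" where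
  "fix_count S f = card {s \<in> S. f s = s}"

definition cycle_index_term ::
  "(nat set \<Rightarrow> 's set) \<Rightarrow> (nat set \<Rightarrow> nat set \<Rightarrow> (nat \<Rightarrow> nat) \<Rightarrow> 's \<Rightarrow> 's) \<Rightarrow>
   ('g \<Rightarrow> nat set \<Rightarrow> 's \<Rightarrow> 's) \<Rightarrow> 'g \<Rightarrow> nat \<Rightarrow> rat mps" where
  "cycle_index_term F tr act g n =
     mps_const (1 / fact n) *
       (\<Sum>\<sigma> | \<sigma> permutes {1..n}.
          mps_const (of_nat (fix_count (F {1..n}) (act g {1..n} \<circ> tr {1..n} {1..n} \<sigma>))) *
          (\<Prod>i=1..n. power_sum i ^ cycle_count {1..n} \<sigma> i))"

definition gamma_cycle_index ::
  "(nat set \<Rightarrow> 's set) \<Rightarrow> (nat set \<Rightarrow> nat set \<Rightarrow> (nat \<Rightarrow> nat) \<Rightarrow> 's \<Rightarrow> 's) \<Rightarrow>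
   ('g \<Rightarrow> nat set \<Rightarrow> 's \<Rightarrow> 's) \<Rightarrow> 'g \<Rightarrow> rat mps" where
  "gamma_cycle_index F tr act g = suminf (cycle_index_term F tr act g)"

lemma sum_cycle_count:
  assumes "\<sigma> permutes {1..n}"
  shows "(\<Sum>i=1..n. cycle_count {1..n} \<sigma> i * i) = n"
proof -
  let ?O = "Orbits.orbit \<sigma>"
  let ?P = "?O ` {1..n}"
  have perm: "permutation \<sigma>" using assms permutation_permutes by blast
  have self: "x \<in> ?O x" for x by (rule permutation_self_in_orbit[OF perm])
  have sub: "?O x \<subseteq> {1..n}" if "x \<in> {1..n}" for x
    using permutes_orbit_subset[OF assms that] .
  have fin: "finite c" if "c \<in> ?P" for c
    using that sub by (metis finite_atLeastAtMost finite_subset imageE)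
  have un: "\<Union>?P = {1..n}" using self sub by blast
  have disj: "c \<inter> d = {}" if "c \<in> ?P" "d \<in> ?P" "c \<noteq> d" for c d
  proof (rule ccontr)
    assume "c \<inter> d \<noteq> {}"
    then obtain z where "z \<in> c" "z \<in> d" by blast
    moreover have "?O z = ?O x" if "z \<in> ?O x" for x
      by (rule orbit_cyclic_eq3[OF cyclic_on_orbit'[OF perm] that])
    ultimately show False using that by auto
  qed
  have rng: "card c \<in> {1..n}" if "c \<in> ?P" for c
  proof -
    from that obtain x where x: "c = ?O x" "x \<in> {1..n}" by blast
    have "card c \<le> card {1..n}" using sub[OF x(2)] x(1) by (intro card_mono) auto
    moreover have "card c > 0" using fin[OF that] self[of x] x(1) by (auto simp: card_gt_0_iff)
    ultimately show ?thesis by simp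
  qed
  have "(\<Sum>i=1..n. cycle_count {1..n} \<sigma> i * i) = (\<Sum>i=1..n. \<Sum>c | c \<in> ?P \<and> card c = i. card c)"
  proof (rule sum.cong[OF refl])
    fix i
    have "{c. (\<exists>x\<in>{1..n}. c = ?O x) \<and> card c = i} = {c. c \<in> ?P \<and> card c = i}" by auto
    then show "cycle_count {1..n} \<sigma> i * i = (\<Sum>c | c \<in> ?P \<and> card c = i. card c)"
      by (simp add: cycle_count_def)
  qed
  also have "\<dots> = (\<Sum>c\<in>?P. card c)"
    by (rule sum.group) (use rng in auto)
  also have "\<dots> = card (\<Union>?P)"
    by (rule card_Union_disjoint[symmetric]) (use fin disj in \<open>auto simp: pairwise_def disjnt_def\<close>)
  finally show ?thesis unfolding un by simp
qed

lemma mps_homogeneous_cycle_index_term: "mps_homogeneous n (cycle_index_term F tr act g n)"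
  unfolding cycle_index_term_def
proof (intro mps_homogeneous_const_mult mps_homogeneous_sum)
  fix \<sigma> assume "\<sigma> \<in> {\<sigma>. \<sigma> permutes {1..n}}"
  then have s: "(\<Sum>i=1..n. cycle_count {1..n} \<sigma> i * i) = n" using sum_cycle_count by blast
  have "mps_homogeneous (\<Sum>i=1..n. cycle_count {1..n} \<sigma> i * i)
      (\<Prod>i=1..n. power_sum i ^ cycle_count {1..n} \<sigma> i)"
    by (intro mps_homogeneous_prod mps_homogeneous_power mps_homogeneous_power_sum)
  then show "mps_homogeneous n (\<Prod>i=1..n. power_sum i ^ cycle_count {1..n} \<sigma> i)"
    unfolding s .
qed

lemma summable_cycle_index: "summable (cycle_index_term F tr act g)"
  by (intro mps_summable mps_homogeneous_imp_ord_ge mps_homogeneous_cycle_index_term)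

section \<open>The species of cyclic orders\<close>

text \<open>
  A triple \<open>(a, b, c)\<close> in a cyclic order means that, going around from \<open>a\<close>, one meets \<open>b\<close>
  before \<open>c\<close>.
\<close>

definition cyclic_order_on :: "'a set \<Rightarrow> ('a \<times> 'a \<times> 'a) set \<Rightarrow> bool" where
  "cyclic_order_on A R \<longleftrightarrow>
     R \<subseteq> A \<times> A \<times> A \<and>
     (\<forall>a b c. (a, b, c) \<in> R \<longrightarrow> (b, c, a) \<in> R) \<and>
     (\<forall>a b c. (a, b, c) \<in> R \<longrightarrow> (c, b, a) \<notin> R) \<and>
     (\<forall>a b c d. (a, b, c) \<in> R \<and> (a, c, d) \<in> R \<longrightarrow> (a, b, d) \<in> R) \<and>
     (\<forall>a\<in>A. \<forall>b\<in>A. \<forall>c\<in>A. a \<noteq> b \<and> b \<noteq> c \<and> a \<noteq> c \<longrightarrow> (a, b, c) \<in> R \<or> (c, b, a) \<in> R)"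

text \<open>
  The empty set carries no structure of this species, although the empty relation on it satisfies
  the axioms.
\<close>

definition cyclic_orders :: "'a set \<Rightarrow> ('a \<times> 'a \<times> 'a) set set" where
  "cyclic_orders A = {R. A \<noteq> {} \<and> cyclic_order_on A R}"

definition cyclic_relabel :: "('a \<Rightarrow> 'b) \<Rightarrow> ('a \<times> 'a \<times> 'a) set \<Rightarrow> ('b \<times> 'b \<times> 'b) set" where
  "cyclic_relabel \<sigma> R = {(\<sigma> a, \<sigma> b, \<sigma> c) | a b c. (a, b, c) \<in> R}"

definition cyclic_reverse :: "('a \<times> 'a \<times> 'a) set \<Rightarrow> ('a \<times> 'a \<times> 'a) set" where
  "cyclic_reverse R = {(c, b, a) | a b c. (a, b, c) \<in> R}"

definition cyclic_transport ::
  "nat set \<Rightarrow> nat set \<Rightarrow> (nat \<Rightarrow> nat) \<Rightarrow> (nat \<times> nat \<times> nat) set \<Rightarrow> (nat \<times> nat \<times> nat) set" where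
  "cyclic_transport A B \<sigma> R = cyclic_relabel \<sigma> R"

text \<open>
  The action of the symmetric group of degree 2. As in the library's \<^const>\<open>group_action\<close>,
  permutations of \<open>C[A]\<close> are functions restricted to \<open>C[A]\<close>.
\<close>

definition cyclic_action ::
  "(nat \<Rightarrow> nat) \<Rightarrow> nat set \<Rightarrow> (nat \<times> nat \<times> nat) set \<Rightarrow> (nat \<times> nat \<times> nat) set" where
  "cyclic_action g A =
     (\<lambda>R \<in> cyclic_orders A. if g = \<one>\<^bsub>sym_group 2\<^esub> then R else cyclic_reverse R)"

lemma cyclic_orders_empty: "cyclic_orders {} = {}"
  by (simp add: cyclic_orders_def)

lemma cyclic_order_onD:
  assumes "cyclic_order_on A R"
  shows "R \<subseteq> A \<times> A \<times> A"
    and "(a, b, c) \<in> R \<Longrightarrow> (b, c, a) \<in> R"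
    and "(a, b, c) \<in> R \<Longrightarrow> (c, b, a) \<notin> R"
    and "(a, b, c) \<in> R \<Longrightarrow> (a, c, d) \<in> R \<Longrightarrow> (a, b, d) \<in> R"
    and "a \<in> A \<Longrightarrow> b \<in> A \<Longrightarrow> c \<in> A \<Longrightarrow> a \<noteq> b \<Longrightarrow> b \<noteq> c \<Longrightarrow> a \<noteq> c
           \<Longrightarrow> (a, b, c) \<in> R \<or> (c, b, a) \<in> R"
proof -
  have *: "R \<subseteq> A \<times> A \<times> A"
    "\<forall>a b c. (a, b, c) \<in> R \<longrightarrow> (b, c, a) \<in> R"
    "\<forall>a b c. (a, b, c) \<in> R \<longrightarrow> (c, b, a) \<notin> R"
    "\<forall>a b c d. (a, b, c) \<in> R \<and> (a, c, d) \<in> R \<longrightarrow> (a, b, d) \<in> R"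
    "\<forall>a\<in>A. \<forall>b\<in>A. \<forall>c\<in>A. a \<noteq> b \<and> b \<noteq> c \<and> a \<noteq> c \<longrightarrow> (a, b, c) \<in> R \<or> (c, b, a) \<in> R"
    using assms unfolding cyclic_order_on_def by - (elim conjE, assumption)+
  show "R \<subseteq> A \<times> A \<times> A" by (rule *(1))
  show "(a, b, c) \<in> R \<Longrightarrow> (b, c, a) \<in> R" using *(2) by iprover
  show "(a, b, c) \<in> R \<Longrightarrow> (c, b, a) \<notin> R" using *(3) by iprover
  show "(a, b, c) \<in> R \<Longrightarrow> (a, c, d) \<in> R \<Longrightarrow> (a, b, d) \<in> R" using *(4) by iprover
  show "a \<in> A \<Longrightarrow> b \<in> A \<Longrightarrow> c \<in> A \<Longrightarrow> a \<noteq> b \<Longrightarrow> b \<noteq> c \<Longrightarrow> a \<noteq> c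
    \<Longrightarrow> (a, b, c) \<in> R \<or> (c, b, a) \<in> R" using *(5) by simp
qed

lemma cyclic_order_on_distinct:
  assumes "cyclic_order_on A R" "(a, b, c) \<in> R"
  shows "a \<noteq> b" "b \<noteq> c" "a \<noteq> c"
  using cyclic_order_onD(2,3)[OF assms(1)] assms(2) by metis+

lemma cyclic_orders_small:
  assumes "card A = 1 \<or> card A = 2"
  shows "cyclic_orders A = {{}}"
proof -
  obtain x y where A: "A = {x, y}"
    using assms by (auto simp: card_1_singleton_iff card_2_iff)
  have "R = {}" if R: "cyclic_order_on A R" for R
  proof (rule ccontr)
    assume "R \<noteq> {}"
    then obtain a b c where abc: "(a, b, c) \<in> R" by auto
    then have "a \<in> A" "b \<in> A" "c \<in> A" using cyclic_order_onD(1)[OF R] by auto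
    then show False using cyclic_order_on_distinct[OF R abc] unfolding A by auto
  qed
  moreover have "cyclic_order_on A {}" unfolding cyclic_order_on_def A by auto
  ultimately show ?thesis unfolding cyclic_orders_def using A by auto
qed

lemma mem_cyclic_reverse [simp]: "(a, b, c) \<in> cyclic_reverse R \<longleftrightarrow> (c, b, a) \<in> R"
  by (auto simp: cyclic_reverse_def)

lemma cyclic_reverse_reverse [simp]: "cyclic_reverse (cyclic_reverse R) = R"
  by auto

lemma cyclic_reverse_relabel:
  "cyclic_reverse (cyclic_relabel \<sigma> R) = cyclic_relabel \<sigma> (cyclic_reverse R)"
  by (auto simp: cyclic_relabel_def) blast+

lemma cyclic_reverse_in:
  assumes "R \<in> cyclic_orders A"
  shows "cyclic_reverse R \<in> cyclic_orders A"
proof -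
  have R: "cyclic_order_on A R" using assms by (simp add: cyclic_orders_def)
  note sub = cyclic_order_onD(1)[OF R] and cyc = cyclic_order_onD(2)[OF R]
    and asy = cyclic_order_onD(3)[OF R] and tra = cyclic_order_onD(4)[OF R]
    and tot = cyclic_order_onD(5)[OF R]
  have "cyclic_order_on A (cyclic_reverse R)"
    unfolding cyclic_order_on_def mem_cyclic_reverse
  proof (intro conjI allI impI ballI)
    show "cyclic_reverse R \<subseteq> A \<times> A \<times> A" using sub by (auto simp: cyclic_reverse_def)
  next
    fix a b c d assume "(c, b, a) \<in> R \<and> (d, c, a) \<in> R"
    then have "(a, d, c) \<in> R" "(a, c, b) \<in> R" by (auto intro: cyc[OF cyc] cyc)
    from cyc[OF tra[OF this]] show "(d, b, a) \<in> R" .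
  next
    fix a b c assume "(c, b, a) \<in> R"
    from cyc[OF cyc[OF this]] show "(a, c, b) \<in> R" .
  next
    fix a b c assume "(c, b, a) \<in> R"
    from asy[OF this] show "(a, b, c) \<notin> R" .
  next
    fix a b c assume "a \<in> A" "b \<in> A" "c \<in> A" "a \<noteq> b \<and> b \<noteq> c \<and> a \<noteq> c"
    then show "(c, b, a) \<in> R \<or> (a, b, c) \<in> R" using tot[of a b c] by auto
  qed
  then show ?thesis using assms by (simp add: cyclic_orders_def)
qed

lemma cyclic_relabel_in:
  assumes \<sigma>: "bij_betw \<sigma> A B" and "R \<in> cyclic_orders A"
  shows "cyclic_relabel \<sigma> R \<in> cyclic_orders B"
proof -
  have R: "cyclic_order_on A R" and ne: "A \<noteq> {}" using assms by (auto simp: cyclic_orders_def)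
  note sub = cyclic_order_onD(1)[OF R] and cyc = cyclic_order_onD(2)[OF R]
    and asy = cyclic_order_onD(3)[OF R] and tra = cyclic_order_onD(4)[OF R]
    and tot = cyclic_order_onD(5)[OF R]
  have inj: "inj_on \<sigma> A" and img: "\<sigma> ` A = B" using \<sigma> by (auto simp: bij_betw_def)
  have mem: "(\<sigma> a, \<sigma> b, \<sigma> c) \<in> cyclic_relabel \<sigma> R \<longleftrightarrow> (a, b, c) \<in> R"
    if "a \<in> A" "b \<in> A" "c \<in> A" for a b c
  proof
    assume "(\<sigma> a, \<sigma> b, \<sigma> c) \<in> cyclic_relabel \<sigma> R"
    then obtain x y z where xyz: "(x, y, z) \<in> R" "\<sigma> a = \<sigma> x" "\<sigma> b = \<sigma> y" "\<sigma> c = \<sigma> z"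
      by (auto simp: cyclic_relabel_def)
    moreover have "x \<in> A" "y \<in> A" "z \<in> A" using xyz(1) sub by auto
    ultimately have "a = x" "b = y" "c = z" using that inj by (simp_all add: inj_on_eq_iff)
    then show "(a, b, c) \<in> R" using xyz(1) by simp
  qed (auto simp: cyclic_relabel_def)
  have subB: "cyclic_relabel \<sigma> R \<subseteq> B \<times> B \<times> B"
    using sub img unfolding cyclic_relabel_def by auto
  have pull: "\<exists>x\<in>A. y = \<sigma> x" if "y \<in> B" for y using that img by blast
  have "cyclic_order_on B (cyclic_relabel \<sigma> R)"
    unfolding cyclic_order_on_def
  proof (intro conjI allI impI ballI)
    show "cyclic_relabel \<sigma> R \<subseteq> B \<times> B \<times> B" by (rule subB)
  next
    fix a b c assume h: "(a, b, c) \<in> cyclic_relabel \<sigma> R"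
    then have "a \<in> B" "b \<in> B" "c \<in> B" using subB by auto
    then obtain x y z where xyz: "x \<in> A" "y \<in> A" "z \<in> A" "a = \<sigma> x" "b = \<sigma> y" "c = \<sigma> z"
      using pull by metis
    then have "(x, y, z) \<in> R" using h mem by simp
    from cyc[OF this] asy[OF this]
    show "(b, c, a) \<in> cyclic_relabel \<sigma> R" "(c, b, a) \<notin> cyclic_relabel \<sigma> R"
      using xyz mem by simp_all
  next
    fix a b c d
    assume h: "(a, b, c) \<in> cyclic_relabel \<sigma> R \<and> (a, c, d) \<in> cyclic_relabel \<sigma> R"
    then have "a \<in> B" "b \<in> B" "c \<in> B" "d \<in> B" using subB by auto
    then obtain x y z w where xyzw: "x \<in> A" "y \<in> A" "z \<in> A" "w \<in> A"
      "a = \<sigma> x" "b = \<sigma> y" "c = \<sigma> z" "d = \<sigma> w"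
      using pull by metis
    then have "(x, y, z) \<in> R" "(x, z, w) \<in> R" using h mem by simp_all
    from tra[OF this] show "(a, b, d) \<in> cyclic_relabel \<sigma> R" using xyzw mem by simp
  next
    fix a b c assume "a \<in> B" "b \<in> B" "c \<in> B" and d: "a \<noteq> b \<and> b \<noteq> c \<and> a \<noteq> c"
    then obtain x y z where "x \<in> A" "y \<in> A" "z \<in> A" "a = \<sigma> x" "b = \<sigma> y" "c = \<sigma> z"
      using pull by metis
    then show "(a, b, c) \<in> cyclic_relabel \<sigma> R \<or> (c, b, a) \<in> cyclic_relabel \<sigma> R"
      using mem tot[of x y z] d by auto
  qed
  then show ?thesis using ne img by (auto simp: cyclic_orders_def)
qed

lemma sym_group_2_mult_cases:
  assumes "g \<in> carrier (sym_group 2)" "h \<in> carrier (sym_group 2)"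
  shows "g \<otimes>\<^bsub>sym_group 2\<^esub> h = \<one>\<^bsub>sym_group 2\<^esub> \<longleftrightarrow>
    (g = \<one>\<^bsub>sym_group 2\<^esub> \<longleftrightarrow> h = \<one>\<^bsub>sym_group 2\<^esub>)"
proof -
  have two: "p = id \<or> p = Transposition.transpose 1 2" if "p permutes {1..2::nat}" for p
  proof -
    have "{1..2::nat} = {1, 2}" by auto
    then show ?thesis using that permutes_doubleton_iff[of p 1 2] by auto
  qed
  have ne: "Transposition.transpose 1 (2::nat) \<noteq> id"
    by (simp add: transpose_eq_id_iff)
  show ?thesis
    using two[of g] two[of h] assms ne
    by (auto simp: sym_group_carrier sym_group_mult sym_group_one)
qed

lemma cyclic_orders_gamma_species:
  "gamma_species (sym_group 2) cyclic_orders cyclic_transport cyclic_action"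
proof (rule gamma_species.intro)
  fix A :: "nat set" assume A: "finite A"
  have "cyclic_orders A \<subseteq> Pow (A \<times> A \<times> A)"
    by (auto simp: cyclic_orders_def cyclic_order_on_def)
  then show "finite (cyclic_orders A)" using A by (meson finite_Pow_iff finite_SigmaI finite_subset)
  show "group_action (sym_group 2) (cyclic_orders A) (\<lambda>g. cyclic_action g A)"
  proof (rule group_action.intro)
    have bij: "cyclic_action g A \<in> Bij (cyclic_orders A)" for g
    proof -
      have "bij_betw (cyclic_action g A) (cyclic_orders A) (cyclic_orders A)"
        by (rule bij_betwI[where g = "cyclic_action g A"])
           (auto simp: cyclic_action_def cyclic_reverse_in)
      then show ?thesis by (simp add: Bij_def cyclic_action_def)
    qed
    have "cyclic_action (g \<otimes>\<^bsub>sym_group 2\<^esub> h) A =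
        compose (cyclic_orders A) (cyclic_action g A) (cyclic_action h A)"
      if "g \<in> carrier (sym_group 2)" "h \<in> carrier (sym_group 2)" for g h
      by (rule ext) (auto simp: cyclic_action_def compose_def cyclic_reverse_in
          sym_group_2_mult_cases[OF that])
    then have "(\<lambda>g. cyclic_action g A) \<in> hom (sym_group 2) (BijGroup (cyclic_orders A))"
      using bij by (auto simp: hom_def BijGroup_def)
    then show "group_hom (sym_group 2) (BijGroup (cyclic_orders A)) (\<lambda>g. cyclic_action g A)"
      by (intro group_hom.intro group_hom_axioms.intro sym_group_is_group group_BijGroup)
  qed
next
  fix A B :: "nat set" and \<sigma> :: "nat \<Rightarrow> nat" and R
  assume "bij_betw \<sigma> A B" "R \<in> cyclic_orders A"
  then show "cyclic_transport A B \<sigma> R \<in> cyclic_orders B"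
    unfolding cyclic_transport_def by (rule cyclic_relabel_in)
next
  fix A B :: "nat set" and \<sigma> \<rho> :: "nat \<Rightarrow> nat" and R
  assume eq: "\<And>x. x \<in> A \<Longrightarrow> \<sigma> x = \<rho> x" and "R \<in> cyclic_orders A"
  then have sub: "R \<subseteq> A \<times> A \<times> A" by (simp add: cyclic_orders_def cyclic_order_on_def)
  have "(\<sigma> a, \<sigma> b, \<sigma> c) = (\<rho> a, \<rho> b, \<rho> c)" if "(a, b, c) \<in> R" for a b c
    using that sub eq by auto
  then show "cyclic_transport A B \<sigma> R = cyclic_transport A B \<rho> R"
    unfolding cyclic_transport_def cyclic_relabel_def by (intro Collect_cong) metis
next
  fix A :: "nat set" and R
  show "cyclic_transport A A id R = R"
    by (auto simp: cyclic_transport_def cyclic_relabel_def)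
next
  fix A B D :: "nat set" and \<sigma> \<rho> :: "nat \<Rightarrow> nat" and R
  show "cyclic_transport A D (\<rho> \<circ> \<sigma>) R = cyclic_transport B D \<rho> (cyclic_transport A B \<sigma> R)"
    by (auto simp: cyclic_transport_def cyclic_relabel_def) blast
next
  fix A B :: "nat set" and \<sigma> g :: "nat \<Rightarrow> nat" and R
  assume "bij_betw \<sigma> A B" "R \<in> cyclic_orders A"
  then show "cyclic_action g B (cyclic_transport A B \<sigma> R) =
      cyclic_transport A B \<sigma> (cyclic_action g A R)"
    by (simp add: cyclic_action_def cyclic_transport_def cyclic_relabel_in cyclic_reverse_relabel)
qed

end

theory Submission
  imports Defs
begin

text \<open>
  The symmetric group acts transitively on the cyclic orders of \<open>[n]\<close>, so conjugation invariance
  of the cycle type reduces the degree-\<open>n\<close> term of the cycle index at \<open>\<gamma>\<close> to the average of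
  \<open>p\<^sub>1\<^bsup>\<sigma>\<^sub>1\<^esup> p\<^sub>2\<^bsup>\<sigma>\<^sub>2\<^esup> \<dots>\<close> over the \<open>n\<close> permutations \<open>\<sigma>\<close> for which \<open>\<gamma> \<circ> C[\<sigma>]\<close> fixes the standard
  cyclic order. For \<open>\<gamma> = e\<close> these are the rotations; the rotation by \<open>j\<close> has \<open>gcd(j, n)\<close> cycles of
  equal length, and \<open>\<phi>(k)\<close> rotations have cycle length \<open>k\<close> for each divisor \<open>k\<close> of \<open>n\<close>. For
  \<open>\<gamma> = \<tau>\<close> these are the reflections: one fixed point each for odd \<open>n\<close>, and alternately two and
  none for even \<open>n\<close>.
\<close>

section \<open>Coefficients of infinite sums\<close>

text \<open>Convergence means that each coefficient is eventually constant along the partial sums.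
  Terms of index above the degree of \<open>m\<close> have coefficient zero at \<open>m\<close>, so
  the constant is already reached at that degree.\<close>

lemma mps_nth_suminf:
  assumes "\<And>n. mps_ord_ge n (f n)"
  shows "mps_nth (suminf f) m = (\<Sum>n\<le>mon_deg m. mps_nth (f n) m)"
proof -
  have "f sums suminf f" using mps_summable[OF assms] by (rule summable_sums)
  then have "eventually (\<lambda>n. mps_nth (sum f {..<n}) m = mps_nth (suminf f) m) sequentially"
    by (simp add: sums_def tendsto_mps_iff)
  then obtain N where N: "\<And>n. n \<ge> N \<Longrightarrow> (\<Sum>i<n. mps_nth (f i) m) = mps_nth (suminf f) m"
    by (auto simp: eventually_sequentially)
  have "(\<Sum>i<N + Suc (mon_deg m). mps_nth (f i) m) = (\<Sum>n\<le>mon_deg m. mps_nth (f n) m)"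
    by (rule sum.mono_neutral_right) (use assms in \<open>auto simp: mps_ord_ge_def\<close>)
  with N[of "N + Suc (mon_deg m)"] show ?thesis by simp
qed

lemma mps_ord_ge_mono: "mps_ord_ge d f \<Longrightarrow> e \<le> d \<Longrightarrow> mps_ord_ge e f"
  by (auto simp: mps_ord_ge_def)

lemma mps_nth_suminf_homogeneous:
  assumes "\<And>n. mps_homogeneous n (f n)"
  shows "mps_nth (suminf f) m = mps_nth (f (mon_deg m)) m"
proof -
  have "mps_nth (suminf f) m = (\<Sum>n\<le>mon_deg m. mps_nth (f n) m)"
    using assms by (intro mps_nth_suminf mps_homogeneous_imp_ord_ge)
  also have "\<dots> = (\<Sum>n\<le>mon_deg m. if n = mon_deg m then mps_nth (f n) m else 0)"
    using assms by (intro sum.cong) (auto simp: mps_homogeneous_def)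
  finally show ?thesis by simp
qed

text \<open>Turns multiplication by a fixed-point count into repeated addition, which makes the
  double counting in \<open>cycle_index_term_transitive\<close> possible.\<close>

lemma mps_const_of_nat: "mps_const (of_nat k) * f = of_nat k * f"
proof (rule mps_eqI)
  fix m
  have "mps_nth (of_nat k * f) m = of_nat k * mps_nth f m"
    by (induction k) (auto simp: algebra_simps)
  then show "mps_nth (mps_const (of_nat k) * f) m = mps_nth (of_nat k * f) m" by simp
qed

section \<open>The logarithm series and its substitution at a power sum\<close>

lemma fps_nth_ln_inverse_1_minus_X: "fps_nth fps_ln_inverse_1_minus_X n = 1 / of_nat n"
proof -
  let ?g = "inverse (1 - fps_X) - 1 :: rat fps"
  have g0: "fps_nth ?g 0 = 0" by simp
  have geo: "inverse (1 - fps_X :: rat fps) = Abs_fps (\<lambda>_. 1)"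
    by (metis fps_inverse_gp' fps_inverse_idempotent fps_nth_Abs_fps one_neq_zero)
  have unit: "(1 - fps_X) * inverse (1 - fps_X :: rat fps) = 1"
    by (rule inverse_mult_eq_1') simp
  have dg: "fps_deriv ?g = inverse (1 - fps_X) ^ 2"
    by (simp add: fps_inverse_deriv)
  \<comment> \<open>With g = 1/(1-X) - 1, the chain rule gives g'/(1+g) = (1-X)(1-X)^(-2) = 1/(1-X),
    a geometric series; coefficients are then read off by integration.\<close>
  have "fps_deriv fps_ln_inverse_1_minus_X = (inverse (1 + fps_X) oo ?g) * fps_deriv ?g"
    unfolding fps_ln_inverse_1_minus_X_def by (simp add: fps_compose_deriv[OF g0] fps_ln_deriv)
  also have "inverse (1 + fps_X) oo ?g = inverse ((1 + fps_X) oo ?g)"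
    by (rule fps_inverse_compose) auto
  also have "(1 + fps_X) oo ?g = inverse (1 - fps_X)"
    using g0 by (simp add: fps_compose_add_distrib)
  also have "inverse \<dots> = 1 - fps_X" by simp
  also have "(1 - fps_X) * fps_deriv ?g = inverse (1 - fps_X)"
    unfolding dg power2_eq_square mult.assoc[symmetric] unit by simp
  finally have d: "fps_deriv fps_ln_inverse_1_minus_X = Abs_fps (\<lambda>_. 1)" unfolding geo .
  show ?thesis
  proof (cases n)
    \<comment> \<open>The constant term is zero, which agrees with
      \<open>1 / of_nat 0 = 0\<close>.\<close>
    case 0
    then show ?thesis by (simp add: fps_ln_inverse_1_minus_X_def)
  next
    case (Suc k)
    have "of_nat (Suc k) * fps_nth fps_ln_inverse_1_minus_X (Suc k) = 1"
      using arg_cong[OF d, of "\<lambda>F. fps_nth F k"] by simp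
    then show ?thesis using Suc by (simp add: field_simps del: of_nat_Suc)
  qed
qed

text \<open>The power p_k^n is homogeneous of degree n k, so at a monomial of degree d only n = d/k
  can contribute, with coefficient 1/n = k/d. For d = 0 both sides vanish because division by zero
  yields zero.\<close>

lemma mps_nth_fps_subst_ln_power_sum:
  assumes "k > 0"
  shows "mps_nth (fps_subst fps_ln_inverse_1_minus_X (power_sum k)) m =
    (if k dvd mon_deg m then of_nat k / of_nat (mon_deg m) * mps_nth (power_sum k ^ (mon_deg m div k)) m
     else 0)"
proof -
  let ?d = "mon_deg m"
  have hom: "mps_homogeneous (n * k) (mps_const c * power_sum k ^ n)" for n c
    by (intro mps_homogeneous_const_mult mps_homogeneous_power mps_homogeneous_power_sum)
  have "mps_nth (fps_subst fps_ln_inverse_1_minus_X (power_sum k)) m =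
      (\<Sum>n\<le>?d. mps_nth (mps_const (1 / of_nat n) * power_sum k ^ n) m)"
    unfolding fps_subst_def fps_nth_ln_inverse_1_minus_X
    using hom assms
    by (intro mps_nth_suminf mps_ord_ge_mono[OF mps_homogeneous_imp_ord_ge[OF hom]]) simp
  also have "\<dots> = (\<Sum>n\<le>?d. if n = ?d div k \<and> k dvd ?d
      then of_nat k / of_nat ?d * mps_nth (power_sum k ^ n) m else 0)"
  proof (rule sum.cong[OF refl])
    fix n
    show "mps_nth (mps_const (1 / of_nat n) * power_sum k ^ n) m =
        (if n = ?d div k \<and> k dvd ?d then of_nat k / of_nat ?d * mps_nth (power_sum k ^ n) m else 0)"
    proof (cases "?d = n * k")
      case True
      then show ?thesis using assms by simp
    next
      case False
      then have "\<not> (n = ?d div k \<and> k dvd ?d)" by auto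
      moreover have "mps_nth (mps_const (1 / of_nat n) * power_sum k ^ n) m = 0"
        using False hom[of n "1 / of_nat n"] unfolding mps_homogeneous_def by blast
      ultimately show ?thesis by (simp only: if_False)
    qed
  qed
  also have "\<dots> = (if k dvd ?d then of_nat k / of_nat ?d * mps_nth (power_sum k ^ (?d div k)) m else 0)"
    by (simp add: div_le_dividend)
  finally show ?thesis .
qed

section \<open>Cycle types and transitive species\<close>

definition cycle_monomial :: "nat \<Rightarrow> (nat \<Rightarrow> nat) \<Rightarrow> rat mps" where
  "cycle_monomial n \<sigma> = (\<Prod>i=1..n. power_sum i ^ cycle_count {1..n} \<sigma> i)"

text \<open>Taking images under \<pi> maps the orbits of \<rho> bijectively to those of its
  conjugate and preserves their sizes.\<close>

lemma cycle_count_conjugate: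
  assumes \<pi>: "\<pi> permutes A" and \<rho>: "\<rho> permutes A" and A: "finite A"
  shows "cycle_count A (\<pi> \<circ> \<rho> \<circ> Hilbert_Choice.inv \<pi>) i = cycle_count A \<rho> i"
proof -
  let ?\<sigma> = "\<pi> \<circ> \<rho> \<circ> Hilbert_Choice.inv \<pi>"
  have inv: "Hilbert_Choice.inv \<pi> (\<pi> x) = x" for x using permutes_inverses(2)[OF \<pi>] .
  have "permutation \<rho>" using \<rho> A permutation_permutes by blast
  then have orb: "Orbits.orbit ?\<sigma> (\<pi> x) = \<pi> ` Orbits.orbit \<rho> x" for x
    by (intro orbit_inverse[symmetric] permutation_self_in_orbit) (auto simp: inv)
  have inj: "inj \<pi>" using \<pi> by (rule permutes_inj)
  have "{c. (\<exists>x\<in>A. c = Orbits.orbit ?\<sigma> x) \<and> card c = i} =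
      image \<pi> ` {c. (\<exists>x\<in>A. c = Orbits.orbit \<rho> x) \<and> card c = i}" (is "?L = _ ` ?R")
  proof (intro equalityI subsetI)
    fix c assume "c \<in> ?L"
    then obtain y where y: "y \<in> A" "c = Orbits.orbit ?\<sigma> y" "card c = i" by auto
    then obtain x where x: "x \<in> A" "y = \<pi> x" using permutes_image[OF \<pi>] by blast
    have "card (Orbits.orbit \<rho> x) = i"
      using y x orb[of x] card_image[OF inj_on_subset[OF inj subset_UNIV]] by metis
    then show "c \<in> image \<pi> ` ?R" using y x orb[of x] by blast
  next
    fix c assume "c \<in> image \<pi> ` ?R"
    then obtain x where x: "x \<in> A" "c = \<pi> ` Orbits.orbit \<rho> x" "card (Orbits.orbit \<rho> x) = i" by auto
    then have "c = Orbits.orbit ?\<sigma> (\<pi> x)" "\<pi> x \<in> A" "card c = i"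
      using orb[of x] permutes_in_image[OF \<pi>] card_image[OF inj_on_subset[OF inj subset_UNIV]] by metis+
    then show "c \<in> ?L" by blast
  qed
  moreover have "inj_on (image \<pi>) ?R" by (intro inj_onI) (simp add: inj_image_eq_iff[OF inj])
  ultimately show ?thesis unfolding cycle_count_def by (simp only: card_image)
qed

lemma cycle_monomial_conjugate:
  assumes "\<pi> permutes {1..n}" "\<rho> permutes {1..n}"
  shows "cycle_monomial n (\<pi> \<circ> \<rho> \<circ> Hilbert_Choice.inv \<pi>) = cycle_monomial n \<rho>"
  unfolding cycle_monomial_def using cycle_count_conjugate[OF assms] by simp

text \<open>\<open>K\<close> is a finite set containing all cycle lengths of \<sigma>. It lets
  products and sums over all lengths collapse to the one or two lengths that rotations and
  reflections can have.\<close>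

context
  fixes n :: nat and \<sigma> :: "nat \<Rightarrow> nat" and K :: "nat set"
  assumes \<sigma>: "\<sigma> permutes {1..n}" and K: "finite K"
    and orbit_sizes: "\<And>x. x \<in> {1..n} \<Longrightarrow> card (Orbits.orbit \<sigma> x) \<in> K"
begin

lemma cycle_count_eq_0:
  assumes "i \<notin> {1..n} \<inter> K"
  shows "cycle_count {1..n} \<sigma> i = 0"
proof -
  have "{c. (\<exists>x\<in>{1..n}. c = Orbits.orbit \<sigma> x) \<and> card c = i} = {}"
  proof (rule ccontr)
    assume "\<not> ?thesis"
    then obtain x where x: "x \<in> {1..n}" "card (Orbits.orbit \<sigma> x) = i" by auto
    have sub: "Orbits.orbit \<sigma> x \<subseteq> {1..n}" using permutes_orbit_subset[OF \<sigma> x(1)] .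
    have "permutation \<sigma>" using \<sigma> permutation_permutes by blast
    then have "x \<in> Orbits.orbit \<sigma> x" by (rule permutation_self_in_orbit)
    then have "i > 0" using x(2) finite_subset[OF sub] by (auto simp: card_gt_0_iff)
    moreover have "i \<le> n" using card_mono[OF _ sub] x(2) by simp
    ultimately show False using assms x orbit_sizes[OF x(1)] by auto
  qed
  then show ?thesis by (simp only: cycle_count_def card.empty)
qed

lemma cycle_monomial_eq: "cycle_monomial n \<sigma> = (\<Prod>i\<in>K. power_sum i ^ cycle_count {1..n} \<sigma> i)"
proof -
  \<comment> \<open>The passage goes through the intersection because \<open>K\<close> may contain
    lengths above \<open>n\<close>, such as 2 when \<open>n = 1\<close>.\<close>
  have "cycle_monomial n \<sigma> = (\<Prod>i\<in>{1..n} \<inter> K. power_sum i ^ cycle_count {1..n} \<sigma> i)"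
    unfolding cycle_monomial_def
    by (rule prod.mono_neutral_right) (auto simp: cycle_count_eq_0 simp del: One_nat_def atLeastAtMost_iff)
  also have "\<dots> = (\<Prod>i\<in>K. power_sum i ^ cycle_count {1..n} \<sigma> i)"
  proof (rule prod.mono_neutral_left[OF K])
    show "{1..n} \<inter> K \<subseteq> K" by blast
    show "\<forall>i\<in>K - {1..n} \<inter> K. power_sum i ^ cycle_count {1..n} \<sigma> i = 1"
    proof
      fix i assume "i \<in> K - {1..n} \<inter> K"
      then have "i \<notin> {1..n} \<inter> K" by blast
      from cycle_count_eq_0[OF this] show "power_sum i ^ cycle_count {1..n} \<sigma> i = 1" by (simp only: power_0)
    qed
  qed
  finally show ?thesis .
qed

lemma sum_cycle_count_eq: "(\<Sum>i\<in>K. cycle_count {1..n} \<sigma> i * i) = n"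
proof -
  have "(\<Sum>i=1..n. cycle_count {1..n} \<sigma> i * i) = (\<Sum>i\<in>{1..n} \<inter> K. cycle_count {1..n} \<sigma> i * i)"
    by (rule sum.mono_neutral_right) (auto simp: cycle_count_eq_0 simp del: One_nat_def atLeastAtMost_iff)
  also have "\<dots> = (\<Sum>i\<in>K. cycle_count {1..n} \<sigma> i * i)"
  proof (rule sum.mono_neutral_left[OF K])
    show "{1..n} \<inter> K \<subseteq> K" by blast
    show "\<forall>i\<in>K - {1..n} \<inter> K. cycle_count {1..n} \<sigma> i * i = 0"
    proof
      fix i assume "i \<in> K - {1..n} \<inter> K"
      then have "i \<notin> {1..n} \<inter> K" by blast
      from cycle_count_eq_0[OF this] show "cycle_count {1..n} \<sigma> i * i = 0" by (simp only: mult_zero_left)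
    qed
  qed
  finally show ?thesis using sum_cycle_count[OF \<sigma>] by simp
qed

end

lemma cycle_monomial_uniform:
  assumes "\<sigma> permutes {1..n}" "s > 0" "\<And>x. x \<in> {1..n} \<Longrightarrow> card (Orbits.orbit \<sigma> x) = s"
  shows "cycle_monomial n \<sigma> = power_sum s ^ (n div s)"
proof -
  have "cycle_monomial n \<sigma> = power_sum s ^ cycle_count {1..n} \<sigma> s"
    using cycle_monomial_eq[OF assms(1), of "{s}"] assms(3) by simp
  \<comment> \<open>The cycles partition the n points, which forces their number.\<close>
  moreover have "cycle_count {1..n} \<sigma> s * s = n"
    using sum_cycle_count_eq[OF assms(1), of "{s}"] assms(3) by simp
  then have "cycle_count {1..n} \<sigma> s = n div s"
    using assms(2) by (metis div_mult_self_is_m)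
  ultimately show ?thesis by simp
qed

text \<open>All cycles have length 1 or 2: the former are the fixed points, and the remaining points
  are paired off by the latter.\<close>

lemma cycle_monomial_involution:
  assumes \<sigma>: "\<sigma> permutes {1..n}" and inv: "\<And>x. x \<in> {1..n} \<Longrightarrow> \<sigma> (\<sigma> x) = x"
  shows "cycle_monomial n \<sigma> = power_sum 1 ^ card {x \<in> {1..n}. \<sigma> x = x} *
    power_sum 2 ^ ((n - card {x \<in> {1..n}. \<sigma> x = x}) div 2)"
proof -
  have orb: "Orbits.orbit \<sigma> x = {x, \<sigma> x}" if "x \<in> {1..n}" for x
  proof -
    have "(\<sigma> ^^ 2) x = x" using inv[OF that] by (simp add: numeral_2_eq_2)
    then have "Orbits.orbit \<sigma> x = {(\<sigma> ^^ m) x | m. m < 2}" by (rule orbit_altdef_bounded) simp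
    also have "{m. m < 2} = {0, 1::nat}" by auto
    then have "{(\<sigma> ^^ m) x | m. m < 2} = (\<lambda>m. (\<sigma> ^^ m) x) ` {0, 1}" by blast
    finally show ?thesis by simp
  qed
  then have sizes: "card (Orbits.orbit \<sigma> x) \<in> {1, 2}" if "x \<in> {1..n}" for x
    using that by (cases "\<sigma> x = x") auto
  have "{c. (\<exists>x\<in>{1..n}. c = Orbits.orbit \<sigma> x) \<and> card c = 1} = (\<lambda>x. {x}) ` {x \<in> {1..n}. \<sigma> x = x}"
    (is "?L = ?R")
  proof (intro equalityI subsetI)
    fix c assume "c \<in> ?L"
    then obtain x where x: "x \<in> {1..n}" "c = {x, \<sigma> x}" "card c = 1" using orb by auto
    then have "\<sigma> x = x" by (cases "\<sigma> x = x") auto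
    then show "c \<in> ?R" using x by auto
  next
    fix c assume "c \<in> ?R"
    then obtain x where "x \<in> {1..n}" "\<sigma> x = x" "c = {x}" by auto
    then show "c \<in> ?L" using orb[of x] by auto
  qed
  then have one: "cycle_count {1..n} \<sigma> 1 = card {x \<in> {1..n}. \<sigma> x = x}"
    unfolding cycle_count_def by (simp add: card_image)
  have "cycle_count {1..n} \<sigma> 1 + cycle_count {1..n} \<sigma> 2 * 2 = n"
    using sum_cycle_count_eq[OF \<sigma> _ sizes] by simp
  then have two: "cycle_count {1..n} \<sigma> 2 = (n - card {x \<in> {1..n}. \<sigma> x = x}) div 2"
    using one by simp
  have "cycle_monomial n \<sigma> = (\<Prod>i\<in>{1, 2}. power_sum i ^ cycle_count {1..n} \<sigma> i)"
    by (rule cycle_monomial_eq[OF \<sigma> _ sizes]) simp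
  also have "\<dots> = power_sum 1 ^ cycle_count {1..n} \<sigma> 1 * power_sum 2 ^ cycle_count {1..n} \<sigma> 2"
    by simp
  finally show ?thesis by (simp only: one two)
qed

text \<open>A weighted Burnside argument. Exchanging the sums over permutations and structures gives
  one inner sum per structure; transitivity makes these inner sums all equal to the one for
  \<open>s0\<close>, and the orbit-stabiliser relation reduces the prefactor to the reciprocal of
  the order of the stabiliser.\<close>

lemma (in gamma_species) cycle_index_term_transitive:
  assumes s0: "s0 \<in> F {1..n}"
    and transitive: "\<And>s. s \<in> F {1..n} \<Longrightarrow> \<exists>\<pi>. \<pi> permutes {1..n} \<and> tr {1..n} {1..n} \<pi> s0 = s"
    and g: "g \<in> carrier \<Gamma>"
  shows "cycle_index_term F tr act g n =
    mps_const (1 / of_nat (card {\<sigma>. \<sigma> permutes {1..n} \<and> tr {1..n} {1..n} \<sigma> s0 = s0})) *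
      (\<Sum>\<sigma> | \<sigma> permutes {1..n} \<and> act g {1..n} (tr {1..n} {1..n} \<sigma> s0) = s0. cycle_monomial n \<sigma>)"
proof -
  define A where "A = {1..n}"
  define P where "P = {\<sigma>. \<sigma> permutes A}"
  define T where "T = tr A A"
  define S where "S s = {\<sigma> \<in> P. act g A (T \<sigma> s) = s}" for s
  define W where "W = (\<Sum>\<sigma>\<in>S s0. cycle_monomial n \<sigma>)"
  define h where "h = card {\<sigma> \<in> P. T \<sigma> s0 = s0}"
  have finA: "finite A" by (simp add: A_def)
  have finP: "finite P" unfolding P_def using finA by (rule finite_permutations)
  have finF: "finite (F A)" using finA by (rule finite_structures)
  have s0A: "s0 \<in> F A" using s0 by (simp add: A_def)
  have bij: "bij_betw \<sigma> A A" if "\<sigma> \<in> P" for \<sigma>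
    using that by (auto simp: P_def permutes_imp_bij)
  have comp_in: "\<rho> \<circ> \<sigma> \<in> P" if "\<rho> \<in> P" "\<sigma> \<in> P" for \<rho> \<sigma>
    using that by (auto simp: P_def permutes_compose)
  have inv_in: "Hilbert_Choice.inv \<sigma> \<in> P" if "\<sigma> \<in> P" for \<sigma>
    using that by (auto simp: P_def permutes_inv)
  have inv_l: "Hilbert_Choice.inv \<sigma> \<circ> \<sigma> = id" and inv_r: "\<sigma> \<circ> Hilbert_Choice.inv \<sigma> = id"
    if "\<sigma> \<in> P" for \<sigma>
    using that by (auto simp: P_def permutes_inv_o)
  have T_in: "T \<sigma> s \<in> F A" if "\<sigma> \<in> P" "s \<in> F A" for \<sigma> s
    unfolding T_def using transport_in[OF finA bij[OF that(1)] that(2)] .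
  have T_comp: "T (\<rho> \<circ> \<sigma>) s = T \<rho> (T \<sigma> s)" if "\<rho> \<in> P" "\<sigma> \<in> P" "s \<in> F A" for \<rho> \<sigma> s
    unfolding T_def using transport_comp[OF finA bij[OF that(2)] bij[OF that(1)] that(3)] .
  have T_id: "T id s = s" if "s \<in> F A" for s
    unfolding T_def using transport_id[OF finA that] .
  have T_inv: "T (Hilbert_Choice.inv \<sigma>) (T \<sigma> s) = s" if "\<sigma> \<in> P" "s \<in> F A" for \<sigma> s
    using T_comp[OF inv_in[OF that(1)] that] inv_l[OF that(1)] T_id[OF that(2)] by simp
  have T_act: "act g A (T \<sigma> s) = T \<sigma> (act g A s)" if "\<sigma> \<in> P" "s \<in> F A" for \<sigma> s
    unfolding T_def using action_transport[OF finA bij[OF that(1)] g that(2)] .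
  have trans: "\<exists>\<pi>\<in>P. T \<pi> s0 = s" if "s \<in> F A" for s
    using transitive[of s] that unfolding P_def T_def A_def by auto

  \<comment> \<open>If \<pi> carries \<open>s0\<close> to \<open>s\<close>, then conjugation by
    \<pi> maps \<open>S s0\<close> bijectively to \<open>S s\<close>, because the action of
    \<open>g\<close> commutes with transport; cycle monomials are unchanged by conjugation.\<close>
  have W_eq: "(\<Sum>\<sigma>\<in>S s. cycle_monomial n \<sigma>) = W" if s: "s \<in> F A" for s
  proof -
    obtain \<pi> where \<pi>: "\<pi> \<in> P" and s_eq: "s = T \<pi> s0" using trans[OF s] by blast
    let ?\<pi>' = "Hilbert_Choice.inv \<pi>"
    note \<pi>' = inv_in[OF \<pi>]
    show ?thesis unfolding W_def
    proof (rule sum.reindex_bij_witness[of _ "\<lambda>\<rho>. \<pi> \<circ> \<rho> \<circ> ?\<pi>'" "\<lambda>\<sigma>. ?\<pi>' \<circ> \<sigma> \<circ> \<pi>"])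
      fix \<sigma> assume "\<sigma> \<in> S s"
      then have \<sigma>: "\<sigma> \<in> P" and fix_s: "act g A (T \<sigma> s) = s" by (auto simp: S_def)
      show "\<pi> \<circ> (?\<pi>' \<circ> \<sigma> \<circ> \<pi>) \<circ> ?\<pi>' = \<sigma>"
        using inv_r[OF \<pi>] by (simp add: fun_eq_iff)
      have \<rho>: "?\<pi>' \<circ> \<sigma> \<circ> \<pi> \<in> P" using comp_in \<pi> \<pi>' \<sigma> by blast
      have "T (?\<pi>' \<circ> \<sigma> \<circ> \<pi>) s0 = T ?\<pi>' (T \<sigma> s)"
        using T_comp[OF comp_in[OF \<pi>' \<sigma>] \<pi> s0A] T_comp[OF \<pi>' \<sigma> s] s_eq by simp
      then have "act g A (T (?\<pi>' \<circ> \<sigma> \<circ> \<pi>) s0) = T ?\<pi>' s"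
        using T_act[OF \<pi>' T_in[OF \<sigma> s]] fix_s by simp
      then show "?\<pi>' \<circ> \<sigma> \<circ> \<pi> \<in> S s0"
        using \<rho> T_inv[OF \<pi> s0A] s_eq by (simp add: S_def)
      have "cycle_monomial n (\<pi> \<circ> (?\<pi>' \<circ> \<sigma> \<circ> \<pi>) \<circ> ?\<pi>') = cycle_monomial n (?\<pi>' \<circ> \<sigma> \<circ> \<pi>)"
        using \<pi> \<rho> by (intro cycle_monomial_conjugate) (auto simp: P_def A_def)
      then show "cycle_monomial n (?\<pi>' \<circ> \<sigma> \<circ> \<pi>) = cycle_monomial n \<sigma>"
        using inv_r[OF \<pi>] by (simp add: fun_eq_iff comp_def)
    next
      fix \<rho> assume "\<rho> \<in> S s0"
      then have \<rho>: "\<rho> \<in> P" and fix_s0: "act g A (T \<rho> s0) = s0" by (auto simp: S_def)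
      show "?\<pi>' \<circ> (\<pi> \<circ> \<rho> \<circ> ?\<pi>') \<circ> \<pi> = \<rho>"
        using inv_l[OF \<pi>] by (simp add: fun_eq_iff)
      have "T (\<pi> \<circ> \<rho> \<circ> ?\<pi>') s = T \<pi> (T \<rho> s0)"
        using T_comp[OF comp_in[OF \<pi> \<rho>] \<pi>' s] T_comp[OF \<pi> \<rho> s0A] T_inv[OF \<pi> s0A] s_eq by simp
      then have "act g A (T (\<pi> \<circ> \<rho> \<circ> ?\<pi>') s) = s"
        using T_act[OF \<pi> T_in[OF \<rho> s0A]] fix_s0 s_eq by simp
      then show "\<pi> \<circ> \<rho> \<circ> ?\<pi>' \<in> S s"
        using comp_in \<pi> \<pi>' \<rho> by (simp add: S_def)
    qed
  qed

  \<comment> \<open>The permutations carrying \<open>s0\<close> to \<open>s\<close> form the left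
    coset of the stabiliser by \<pi>.\<close>
  have fibre: "card {\<sigma> \<in> P. T \<sigma> s0 = s} = h" if s: "s \<in> F A" for s
  proof -
    obtain \<pi> where \<pi>: "\<pi> \<in> P" and s_eq: "s = T \<pi> s0" using trans[OF s] by blast
    let ?\<pi>' = "Hilbert_Choice.inv \<pi>"
    note \<pi>' = inv_in[OF \<pi>]
    have "bij_betw (\<lambda>\<sigma>. \<pi> \<circ> \<sigma>) {\<sigma> \<in> P. T \<sigma> s0 = s0} {\<sigma> \<in> P. T \<sigma> s0 = s}"
    proof (rule bij_betw_byWitness[where f' = "\<lambda>\<sigma>. ?\<pi>' \<circ> \<sigma>"])
      show "\<forall>\<sigma>\<in>{\<sigma> \<in> P. T \<sigma> s0 = s0}. ?\<pi>' \<circ> (\<pi> \<circ> \<sigma>) = \<sigma>"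
        by (simp add: comp_assoc[symmetric] inv_l[OF \<pi>])
      show "\<forall>\<sigma>\<in>{\<sigma> \<in> P. T \<sigma> s0 = s}. \<pi> \<circ> (?\<pi>' \<circ> \<sigma>) = \<sigma>"
        by (simp add: comp_assoc[symmetric] inv_r[OF \<pi>])
      show "(\<lambda>\<sigma>. \<pi> \<circ> \<sigma>) ` {\<sigma> \<in> P. T \<sigma> s0 = s0} \<subseteq> {\<sigma> \<in> P. T \<sigma> s0 = s}"
        using comp_in[OF \<pi>] T_comp[OF \<pi> _ s0A] by (auto simp: s_eq)
      show "(\<lambda>\<sigma>. ?\<pi>' \<circ> \<sigma>) ` {\<sigma> \<in> P. T \<sigma> s0 = s} \<subseteq> {\<sigma> \<in> P. T \<sigma> s0 = s0}"
        using comp_in[OF \<pi>'] T_comp[OF \<pi>' _ s0A] T_inv[OF \<pi> s0A] by (auto simp: s_eq)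
    qed
    from bij_betw_same_card[OF this] show ?thesis by (simp add: h_def)
  qed
  have "id \<in> {\<sigma> \<in> P. T \<sigma> s0 = s0}" using T_id[OF s0A] by (simp add: P_def permutes_id)
  then have h_pos: "h > 0" unfolding h_def using finP by (auto simp: card_gt_0_iff)
  \<comment> \<open>Sorting all permutations by the image of \<open>s0\<close> gives one fibre of
    size \<open>h\<close> for each structure.\<close>
  have "(fact n :: nat) = card P"
    unfolding P_def using finA by (simp add: card_permutations A_def)
  also have "\<dots> = (\<Sum>\<sigma>\<in>P. 1)" by simp
  also have "\<dots> = (\<Sum>s\<in>F A. \<Sum>\<sigma>\<in>{\<sigma> \<in> P. T \<sigma> s0 = s}. 1)"
    by (rule sum.group[symmetric]) (use finP finF T_in s0A in auto)
  also have "\<dots> = card (F A) * h" using fibre by simp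
  finally have "(of_nat (fact n) :: rat) = of_nat (card (F A)) * of_nat h"
    by (metis of_nat_mult)
  then have fact_eq: "(fact n :: rat) = of_nat (card (F A)) * of_nat h" by simp

  have "(\<Sum>\<sigma>\<in>P. mps_const (of_nat (fix_count (F A) (act g A \<circ> T \<sigma>))) * cycle_monomial n \<sigma>) =
      (\<Sum>\<sigma>\<in>P. \<Sum>s | s \<in> F A \<and> act g A (T \<sigma> s) = s. cycle_monomial n \<sigma>)"
    by (simp add: mps_const_of_nat fix_count_def)
  also have "\<dots> = (\<Sum>s\<in>F A. \<Sum>\<sigma> | \<sigma> \<in> P \<and> act g A (T \<sigma> s) = s. cycle_monomial n \<sigma>)"
    by (rule sum.swap_restrict[OF finP finF])
  also have "\<dots> = (\<Sum>s\<in>F A. W)"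
    using W_eq by (intro sum.cong) (auto simp: S_def)
  also have "\<dots> = mps_const (of_nat (card (F A))) * W"
    by (simp add: mps_const_of_nat)
  finally have "cycle_index_term F tr act g n =
      mps_const (1 / fact n) * (mps_const (of_nat (card (F A))) * W)"
    unfolding cycle_index_term_def cycle_monomial_def P_def T_def A_def by simp
  also have "\<dots> = mps_const (1 / of_nat h) * W"
  proof (rule mps_eqI)
    fix m
    have "card (F A) > 0" using finF s0A by (auto simp: card_gt_0_iff)
    then show "mps_nth (mps_const (1 / fact n) * (mps_const (of_nat (card (F A))) * W)) m =
        mps_nth (mps_const (1 / of_nat h) * W) m"
      using h_pos by (simp add: fact_eq)
  qed
  finally show ?thesis unfolding h_def W_def S_def P_def T_def A_def by simp
qed

section \<open>The standard cyclic order\<close>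

text \<open>The disjunction says that one of the three cyclic shifts of the triple is
  increasing.\<close>

definition standard_cyclic_order :: "nat \<Rightarrow> (nat \<times> nat \<times> nat) set" where
  "standard_cyclic_order n = {(a, b, c). a \<in> {1..n} \<and> b \<in> {1..n} \<and> c \<in> {1..n} \<and>
     (a < b \<and> b < c \<or> b < c \<and> c < a \<or> c < a \<and> a < b)}"

lemma mem_standard_cyclic_order:
  "(a, b, c) \<in> standard_cyclic_order n \<longleftrightarrow> a \<in> {1..n} \<and> b \<in> {1..n} \<and> c \<in> {1..n} \<and>
     (a < b \<and> b < c \<or> b < c \<and> c < a \<or> c < a \<and> a < b)"
  by (simp add: standard_cyclic_order_def)

lemma standard_cyclic_order_in: "n > 0 \<Longrightarrow> standard_cyclic_order n \<in> cyclic_orders {1..n}"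
  unfolding cyclic_orders_def cyclic_order_on_def mem_standard_cyclic_order
  by (auto simp: standard_cyclic_order_def)

text \<open>A triple of \<open>R'\<close> has distinct entries, so totality puts it or its reversal
  in \<open>R\<close>; the reversal would lie in \<open>R'\<close> too, against asymmetry. Hence
  equalities of relabelled orders need only one inclusion.\<close>

lemma cyclic_orders_subset_eq:
  assumes R: "R \<in> cyclic_orders A" and R': "R' \<in> cyclic_orders A" and sub: "R \<subseteq> R'"
  shows "R = R'"
proof (rule equalityI[OF sub])
  have cR: "cyclic_order_on A R" and cR': "cyclic_order_on A R'"
    using R R' by (auto simp: cyclic_orders_def)
  show "R' \<subseteq> R"
  proof
    fix t assume t: "t \<in> R'"
    obtain a b c where abc: "t = (a, b, c)" by (cases t)
    have "a \<in> A" "b \<in> A" "c \<in> A" using cyclic_order_onD(1)[OF cR'] t abc by auto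
    then have "(a, b, c) \<in> R \<or> (c, b, a) \<in> R"
      using cyclic_order_onD(5)[OF cR] cyclic_order_on_distinct[OF cR'] t abc by metis
    moreover have "(c, b, a) \<notin> R" using cyclic_order_onD(3)[OF cR'] t abc sub by blast
    ultimately show "t \<in> R" using abc by blast
  qed
qed

lemma cyclic_relabel_eqI:
  assumes "\<sigma> permutes A" "R \<in> cyclic_orders A" "R' \<in> cyclic_orders A"
    and "\<And>a b c. (a, b, c) \<in> R \<Longrightarrow> (\<sigma> a, \<sigma> b, \<sigma> c) \<in> R'"
  shows "cyclic_relabel \<sigma> R = R'"
proof (rule cyclic_orders_subset_eq)
  show "cyclic_relabel \<sigma> R \<in> cyclic_orders A"
    by (rule cyclic_relabel_in[OF permutes_imp_bij]) (use assms in auto)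
qed (use assms in \<open>auto simp: cyclic_relabel_def\<close>)

lemma cyclic_relabel_comp: "cyclic_relabel (\<rho> \<circ> \<sigma>) R = cyclic_relabel \<rho> (cyclic_relabel \<sigma> R)"
  by (auto simp: cyclic_relabel_def) blast

lemma cyclic_relabel_id: "cyclic_relabel id R = R"
  by (auto simp: cyclic_relabel_def)

text \<open>
  Cutting a cyclic order open at a point gives a linear order, and numbering the points along it
  carries the cyclic order to the standard one.
\<close>

lemma cyclic_orders_transitive:
  assumes "R \<in> cyclic_orders {1..n}"
  shows "\<exists>\<pi>. \<pi> permutes {1..n} \<and> cyclic_relabel \<pi> (standard_cyclic_order n) = R"
proof -
  define A where "A = {1..n}"
  have R: "cyclic_order_on A R" and "A \<noteq> {}" using assms by (auto simp: cyclic_orders_def A_def)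
  then obtain o\<^sub>0 where o: "o\<^sub>0 \<in> A" by blast
  have finA: "finite A" by (simp add: A_def)
  have n: "n > 0" using \<open>A \<noteq> {}\<close> by (simp add: A_def)
  note sub = cyclic_order_onD(1)[OF R] and cyc = cyclic_order_onD(2)[OF R]
    and asy = cyclic_order_onD(3)[OF R] and tra = cyclic_order_onD(4)[OF R]
    and tot = cyclic_order_onD(5)[OF R] and dist = cyclic_order_on_distinct[OF R]
  \<comment> \<open>The order in which points are met when going around from
    \<open>o\<^sub>0\<close>. The second disjunct makes \<open>o\<^sub>0\<close> the least point,
    since triples of \<open>R\<close> have no repeated entries.\<close>
  define L where "L x y \<longleftrightarrow> (o\<^sub>0, x, y) \<in> R \<or> x = o\<^sub>0 \<and> y \<noteq> o\<^sub>0" for x y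
  have L_irrefl: "\<not> L x x" for x using dist unfolding L_def by blast
  have L_trans: "L x z" if "L x y" "L y z" for x y z
    using that tra dist unfolding L_def by blast
  have L_total: "L x y \<or> L y x" if "x \<in> A" "y \<in> A" "x \<noteq> y" for x y
  proof (cases "x = o\<^sub>0 \<or> y = o\<^sub>0")
    case False
    then have "(o\<^sub>0, x, y) \<in> R \<or> (y, x, o\<^sub>0) \<in> R" using tot[OF o that(1,2)] that(3) by auto
    then show ?thesis using cyc unfolding L_def by blast
  qed (use that in \<open>auto simp: L_def\<close>)
  have L_imp: "(x, y, z) \<in> R" if "L x y" "L y z" for x y z
  proof -
    have yz: "(o\<^sub>0, y, z) \<in> R" using that dist L_irrefl unfolding L_def by blast
    show ?thesis
    proof (cases "x = o\<^sub>0")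
      case False
      then have "(o\<^sub>0, x, y) \<in> R" using that by (simp add: L_def)
      \<comment> \<open>Both triples are rotated to start at \<open>y\<close>, so that transitivity
        applies there and yields \<open>(y, z, x)\<close>.\<close>
      then have "(y, o\<^sub>0, x) \<in> R" using cyc by blast
      with tra[OF cyc[OF yz]] show ?thesis using cyc by blast
    qed (use yz in simp)
  qed
  \<comment> \<open>The position of \<open>x\<close> in the linear order, counted from 1; the
    identity outside \<open>A\<close> makes it a permutation in the sense of
    \<open>permutes\<close>.\<close>
  define f where "f x = (if x \<in> A then Suc (card {y \<in> A. L y x}) else x)" for x
  have f_mono: "f x < f y" if "x \<in> A" "y \<in> A" "L x y" for x y
  proof -
    have "{z \<in> A. L z x} \<subset> {z \<in> A. L z y}"
      using that L_trans L_irrefl by blast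
    then show ?thesis using that finA by (simp add: f_def psubset_card_mono)
  qed
  have "inj_on f A"
  proof (rule inj_onI)
    fix x y assume xy: "x \<in> A" "y \<in> A" "f x = f y"
    show "x = y"
    proof (rule ccontr)
      assume "x \<noteq> y"
      then have "L x y \<or> L y x" using L_total xy by blast
      then show False using f_mono xy by fastforce
    qed
  qed
  moreover have f_in: "f ` A \<subseteq> A"
  proof (rule image_subsetI)
    fix x assume x: "x \<in> A"
    have "{y \<in> A. L y x} \<subset> A" using x L_irrefl by blast
    from psubset_card_mono[OF finA this] have "card {y \<in> A. L y x} < n" by (simp add: A_def)
    then show "f x \<in> A" using x by (simp add: f_def A_def)
  qed
  ultimately have "bij_betw f A A" using finA by (simp add: bij_betw_def endo_inj_surj)
  then have f: "f permutes A" by (rule bij_imp_permutes) (simp add: f_def)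
  have "cyclic_relabel f R = standard_cyclic_order n"
  proof (rule cyclic_relabel_eqI[OF f])
    show "R \<in> cyclic_orders A" using assms by (simp add: A_def)
    show "standard_cyclic_order n \<in> cyclic_orders A"
      using standard_cyclic_order_in[OF n] by (simp add: A_def)
    fix a b c assume abc: "(a, b, c) \<in> R"
    then have A: "a \<in> A" "b \<in> A" "c \<in> A" using sub by auto
    have "f a \<in> A" "f b \<in> A" "f c \<in> A" using A f_in by auto
    \<comment> \<open>Of the six linear arrangements of the three points, the other three would put
      a shift of the reversed triple into \<open>R\<close>.\<close>
    moreover have "L a b \<and> L b c \<or> L b c \<and> L c a \<or> L c a \<and> L a b"
    proof -
      have neg: "(a, c, b) \<notin> R" "(c, b, a) \<notin> R" "(b, a, c) \<notin> R" using abc cyc asy by blast+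
      have "L a b \<or> L b a" "L b c \<or> L c b" "L a c \<or> L c a"
        using L_total A dist[OF abc] by blast+
      then show ?thesis using L_imp neg by blast
    qed
    ultimately show "(f a, f b, f c) \<in> standard_cyclic_order n"
      using f_mono A unfolding mem_standard_cyclic_order A_def by blast
  qed
  \<comment> \<open>The numbering carries \<open>R\<close> to the standard order, so its inverse is
    the required witness.\<close>
  then have "cyclic_relabel (Hilbert_Choice.inv f) (standard_cyclic_order n) =
      cyclic_relabel (Hilbert_Choice.inv f \<circ> f) R"
    by (simp add: cyclic_relabel_comp)
  also have "\<dots> = R" using permutes_inv_o(2)[OF f] by (simp add: cyclic_relabel_id)
  finally show ?thesis using permutes_inv[OF f] unfolding A_def by blast
qed

section \<open>Rotations and reflections\<close>

definition rotation :: "nat \<Rightarrow> nat \<Rightarrow> nat \<Rightarrow> nat" where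
  "rotation n j x = (if x \<in> {1..n} then Suc ((x - 1 + j) mod n) else x)"

lemma rotation_permutes: "rotation n j permutes {1..n}"
proof -
  have sub: "rotation n j ` {1..n} \<subseteq> {1..n}" by (auto simp: rotation_def Suc_le_eq)
  have inj: "inj_on (rotation n j) {1..n}"
  proof (rule inj_onI)
    fix x y assume xy: "x \<in> {1..n}" "y \<in> {1..n}" "rotation n j x = rotation n j y"
    then have "[x - 1 + j = y - 1 + j] (mod n)" by (simp add: rotation_def cong_def)
    then have "[x - 1 = y - 1] (mod n)" by (simp only: cong_add_rcancel_nat)
    then show "x = y" using xy by (auto simp: cong_def)
  qed
  have "bij_betw (rotation n j) {1..n} {1..n}"
    using endo_inj_surj[OF _ sub inj] inj by (simp add: bij_betw_def)
  then show ?thesis by (rule bij_imp_permutes) (simp only: rotation_def if_False)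
qed

lemma rotation_funpow:
  assumes "x \<in> {1..n}"
  shows "(rotation n j ^^ k) x = Suc ((x - 1 + k * j) mod n)"
proof (induction k)
  case 0
  then show ?case using assms by auto
next
  case (Suc k)
  have "(x - 1 + k * j) mod n < n" using assms by simp
  then have "(rotation n j ^^ Suc k) x = Suc (((x - 1 + k * j) mod n + j) mod n)"
    using Suc by (simp add: rotation_def[of n j "Suc _"])
  also have "\<dots> = Suc ((x - 1 + k * j + j) mod n)" by (simp only: mod_add_left_eq)
  finally show ?case by (simp only: mult_Suc add_ac)
qed

text \<open>Reduces the invariance of the standard order under every rotation to the rotation by one
  step.\<close>

lemma rotation_1_funpow: "rotation n 1 ^^ j = rotation n j"
proof
  fix x
  show "(rotation n 1 ^^ j) x = rotation n j x"
  proof (cases "x \<in> {1..n}")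
    case True
    then show ?thesis by (simp only: rotation_funpow rotation_def if_True mult_1_right)
  next
    case False
    then have "(rotation n 1 ^^ k) x = x" for k by (induction k) (auto simp: rotation_def)
    then show ?thesis using False by (simp only: rotation_def if_False)
  qed
qed

lemma rotation_1: "x \<in> {1..n} \<Longrightarrow> rotation n 1 x = (if x = n then 1 else Suc x)"
  by (auto simp: rotation_def)

text \<open>With indices taken from 1 to \<open>n\<close>, the index of a rotation is the image of
  \<open>n\<close>; the identity has index \<open>n\<close>. This gives injectivity of the indexing
  and later identifies a stabilising permutation.\<close>

lemma rotation_n: "j \<in> {1..n} \<Longrightarrow> rotation n j n = j"
  by (cases j) (auto simp: rotation_def)

lemma inj_on_rotation: "inj_on (rotation n) {1..n}"
  by (rule inj_onI) (metis rotation_n)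

lemma cyclic_relabel_rotation:
  assumes "n > 0"
  shows "cyclic_relabel (rotation n j) (standard_cyclic_order n) = standard_cyclic_order n"
proof -
  have "cyclic_relabel (rotation n 1) (standard_cyclic_order n) = standard_cyclic_order n"
  proof (rule cyclic_relabel_eqI[OF rotation_permutes])
    fix a b c assume abc: "(a, b, c) \<in> standard_cyclic_order n"
    then have "a \<in> {1..n}" "b \<in> {1..n}" "c \<in> {1..n}" by (auto simp: mem_standard_cyclic_order)
    then show "(rotation n 1 a, rotation n 1 b, rotation n 1 c) \<in> standard_cyclic_order n"
      using abc by (simp only: rotation_1) (auto simp: mem_standard_cyclic_order)
  qed (use standard_cyclic_order_in[OF assms] in auto)
  then have "cyclic_relabel (rotation n 1 ^^ j) (standard_cyclic_order n) = standard_cyclic_order n"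
    by (induction j) (simp_all add: cyclic_relabel_id cyclic_relabel_comp del: One_nat_def)
  then show ?thesis by (simp only: rotation_1_funpow)
qed

text \<open>The next point after \<open>a\<close> is the one that no other point precedes when going
  around from \<open>a\<close>. For \<open>n = 1\<close> the rotation fixes \<open>a\<close>, so the
  condition \<open>b \<noteq> a\<close> would fail.\<close>

lemma standard_cyclic_order_successor:
  assumes "a \<in> {1..n}" "n \<ge> 2"
  shows "b = rotation n 1 a \<longleftrightarrow> b \<in> {1..n} \<and> b \<noteq> a \<and> (\<nexists>c. (a, c, b) \<in> standard_cyclic_order n)"
proof
  assume "b = rotation n 1 a"
  then have b: "b = (if a = n then 1 else Suc a)" using assms(1) by (simp only: rotation_1)
  then show "b \<in> {1..n} \<and> b \<noteq> a \<and> (\<nexists>c. (a, c, b) \<in> standard_cyclic_order n)"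
    using assms by (auto simp: mem_standard_cyclic_order)
next
  assume R: "b \<in> {1..n} \<and> b \<noteq> a \<and> (\<nexists>c. (a, c, b) \<in> standard_cyclic_order n)"
  show "b = rotation n 1 a"
  proof (rule ccontr)
    assume "b \<noteq> rotation n 1 a"
    then have "b \<noteq> (if a = n then 1 else Suc a)"
      by (simp only: rotation_1[OF assms(1)] not_False_eq_True)
    \<comment> \<open>If \<open>b\<close> is neither \<open>a\<close> nor the next point, the next
      point itself lies between \<open>a\<close> and \<open>b\<close>.\<close>
    then have "(a, if a = n then 1 else Suc a, b) \<in> standard_cyclic_order n"
      using conjunct1[OF R] conjunct1[OF conjunct2[OF R]] assms
      by (auto simp: mem_standard_cyclic_order)
    then show False using R by blast
  qed
qed

text \<open>The successor relation is definable from the cyclic order, so a stabilising permutation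
  commutes with \<^term>\<open>rotation n 1\<close> and is determined by its value at a single point.\<close>

lemma stabilizer_standard_cyclic_order:
  assumes n: "n > 0"
  shows "{\<sigma>. \<sigma> permutes {1..n} \<and>
      cyclic_relabel \<sigma> (standard_cyclic_order n) = standard_cyclic_order n} = rotation n ` {1..n}"
    (is "?S = _")
proof (intro equalityI subsetI)
  fix \<sigma> assume "\<sigma> \<in> rotation n ` {1..n}"
  then show "\<sigma> \<in> ?S" using rotation_permutes cyclic_relabel_rotation[OF n] by auto
next
  fix \<sigma> assume "\<sigma> \<in> ?S"
  then have \<sigma>: "\<sigma> permutes {1..n}"
    and stab: "cyclic_relabel \<sigma> (standard_cyclic_order n) = standard_cyclic_order n" by auto
  have in_A: "\<sigma> x \<in> {1..n} \<longleftrightarrow> x \<in> {1..n}" for x using permutes_in_image[OF \<sigma>] .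
  have inj: "\<sigma> x = \<sigma> y \<longleftrightarrow> x = y" for x y using permutes_inj[OF \<sigma>] by (simp add: inj_eq)
  have step: "\<sigma> (rotation n 1 x) = rotation n 1 (\<sigma> x)" if x: "x \<in> {1..n}" for x
  proof (cases "n \<ge> 2")
    case True
    let ?y = "rotation n 1 x"
    have y: "?y \<in> {1..n}" "?y \<noteq> x" "\<nexists>c. (x, c, ?y) \<in> standard_cyclic_order n"
      using standard_cyclic_order_successor[OF x True, of ?y] by blast+
    have "(\<sigma> x, c, \<sigma> ?y) \<notin> standard_cyclic_order n" for c
    proof
      assume "(\<sigma> x, c, \<sigma> ?y) \<in> standard_cyclic_order n"
      then have "(\<sigma> x, c, \<sigma> ?y) \<in> cyclic_relabel \<sigma> (standard_cyclic_order n)" using stab by simp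
      then obtain c' where "(x, c', ?y) \<in> standard_cyclic_order n"
        unfolding cyclic_relabel_def by (auto simp only: mem_Collect_eq prod.inject inj)
      then show False using y(3) by blast
    qed
    moreover have "\<sigma> ?y \<in> {1..n}" "\<sigma> ?y \<noteq> \<sigma> x" using y in_A inj by blast+
    moreover have "\<sigma> x \<in> {1..n}" using x in_A by blast
    ultimately show ?thesis using standard_cyclic_order_successor[OF _ True] by blast
  next
    case False
    then have "n = 1" using n by simp
    moreover have "rotation n 1 x \<in> {1..n}" "rotation n 1 (\<sigma> x) \<in> {1..n}" "\<sigma> (rotation n 1 x) \<in> {1..n}"
      using x in_A permutes_in_image[OF rotation_permutes] by blast+
    ultimately show ?thesis by simp
  qed
  define j where "j = \<sigma> n"
  have j: "j \<in> {1..n}" using in_A[of n] n by (simp add: j_def)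
  \<comment> \<open>Induction along successors, starting at 1, which is the successor of
    \<open>n\<close>; there the choice of \<open>j\<close> as the image of \<open>n\<close>
    enters.\<close>
  have pos: "\<sigma> x = rotation n j x" if "x \<ge> 1" "x \<le> n" for x
    using that
  proof (induction x rule: dec_induct)
    case base
    have "\<sigma> 1 = \<sigma> (rotation n 1 n)" using rotation_n[of 1 n] n by simp
    also have "\<dots> = rotation n 1 j" using step[of n] n by (simp add: j_def)
    also have "\<dots> = rotation n j 1" using j n by (simp add: rotation_def)
    finally show ?case .
  next
    case (step x)
    have x: "x \<in> {1..n}" "x \<noteq> n" using step by auto
    have "\<sigma> (Suc x) = \<sigma> (rotation n 1 x)" using x by (simp only: rotation_1 if_False)
    also have "\<dots> = rotation n 1 (rotation n j x)"
      using \<open>\<And>x. x \<in> {1..n} \<Longrightarrow> \<sigma> (rotation n 1 x) = rotation n 1 (\<sigma> x)\<close>[OF x(1)] step x by simp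
    also have "\<dots> = rotation n j (Suc x)"
      using x n by (cases x) (auto simp: rotation_def mod_Suc_eq Suc_le_eq)
    finally show ?case .
  qed
  have "\<sigma> x = rotation n j x" for x
  proof (cases "x \<in> {1..n}")
    case False
    then show ?thesis using permutes_not_in[OF \<sigma> False] by (simp only: rotation_def if_False)
  qed (use pos in auto)
  then show "\<sigma> \<in> rotation n ` {1..n}" using j by blast
qed

text \<open>The \<open>k\<close>-th power of the rotation shifts by \<open>k * j\<close>, and
  \<open>n div gcd j n\<close> is the least positive \<open>k\<close> for which \<open>n\<close>
  divides this.\<close>

lemma card_orbit_rotation:
  assumes x: "x \<in> {1..n}"
  shows "card (Orbits.orbit (rotation n j) x) = n div gcd j n"
proof -
  let ?g = "gcd j n"
  let ?s = "n div ?g"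
  have n: "n > 0" using x by simp
  have g: "?g > 0" using n by simp
  have ns: "n = ?s * ?g" by simp
  have s: "?s > 0" using ns n by (metis gr0I mult_zero_left)
  have "n dvd ?s * j" by (metis dvd_mult_cancel1 dvd_triv_left gcd_dvd1 mult.commute mult_dvd_mono ns dvd_refl)
  then obtain q where q: "?s * j = n * q" by (elim dvdE)
  have "(rotation n j ^^ ?s) x = Suc ((x - 1) mod n)"
    by (simp only: rotation_funpow[OF x] q mod_mult_self2)
  then have "(rotation n j ^^ ?s) x = x" using x by auto
  then have "Orbits.orbit (rotation n j) x = {(rotation n j ^^ m) x | m. m < ?s}"
    using s by (rule orbit_altdef_bounded)
  also have "\<dots> = (\<lambda>m. (rotation n j ^^ m) x) ` {..<?s}" by blast
  finally have orb: "Orbits.orbit (rotation n j) x = (\<lambda>m. (rotation n j ^^ m) x) ` {..<?s}" .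
  have neq: False if "k < m" "m < ?s" "(rotation n j ^^ k) x = (rotation n j ^^ m) x" for k m
  proof -
    have "[x - 1 + m * j = x - 1 + k * j] (mod n)"
      using that(3) x by (simp add: rotation_funpow cong_def)
    then have "[m * j = k * j] (mod n)" by (simp only: cong_add_lcancel_nat)
    then have "n dvd m * j - k * j" using that(1) by (simp add: cong_altdef_nat)
    then have "n dvd (m - k) * j" by (simp add: diff_mult_distrib)
    \<comment> \<open>As \<open>n\<close> also divides \<open>(m - k) * n\<close>, it divides
      \<open>m - k\<close> times \<open>gcd j n\<close>; cancelling the gcd contradicts
      \<open>m - k < n div gcd j n\<close>.\<close>
    then have "n dvd gcd ((m - k) * j) ((m - k) * n)" by simp
    then have "?s * ?g dvd (m - k) * ?g" using ns by (simp add: gcd_mult_distrib_nat[symmetric])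
    then have "?s dvd m - k" using g by (simp only: dvd_mult_cancel2 nat_mult_dvd_cancel_disj dvd_times_right_cancel_iff)
    then show False using that by (auto dest: dvd_imp_le)
  qed
  have "inj_on (\<lambda>m. (rotation n j ^^ m) x) {..<?s}"
    by (rule inj_onI) (metis neq lessThan_iff linorder_neqE_nat)
  then show ?thesis unfolding orb by (simp add: card_image)
qed

lemma cycle_monomial_rotation:
  assumes "n > 0"
  shows "cycle_monomial n (rotation n j) = power_sum (n div gcd j n) ^ (n div (n div gcd j n))"
proof (rule cycle_monomial_uniform[OF rotation_permutes])
  show "n div gcd j n > 0" using assms by (simp add: div_greater_zero_iff gcd_le2_nat)
qed (rule card_orbit_rotation)

section \<open>Reflections of the standard cyclic order\<close>

definition reversal :: "nat \<Rightarrow> nat \<Rightarrow> nat" where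
  "reversal n x = (if x \<in> {1..n} then Suc n - x else x)"

lemma reversal_reversal: "reversal n \<circ> reversal n = id"
  by (auto simp: reversal_def fun_eq_iff)

lemma reversal_permutes: "reversal n permutes {1..n}"
  by (rule bij_imp_permutes, rule bij_betw_byWitness[of _ "reversal n"]) (auto simp: reversal_def)

lemma cyclic_relabel_reversal:
  assumes "n > 0"
  shows "cyclic_relabel (reversal n) (standard_cyclic_order n) =
    cyclic_reverse (standard_cyclic_order n)"
proof (rule cyclic_relabel_eqI[OF reversal_permutes])
  show "standard_cyclic_order n \<in> cyclic_orders {1..n}" using assms by (rule standard_cyclic_order_in)
  then show "cyclic_reverse (standard_cyclic_order n) \<in> cyclic_orders {1..n}"
    by (rule cyclic_reverse_in)
qed (auto simp: mem_standard_cyclic_order reversal_def)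

text \<open>Composing with the reversal turns a direction-reversing permutation into a stabilising
  one, so the reflections form a coset of the rotations.\<close>

lemma reverse_stabilizer_standard_cyclic_order:
  assumes n: "n > 0"
  shows "{\<sigma>. \<sigma> permutes {1..n} \<and>
      cyclic_reverse (cyclic_relabel \<sigma> (standard_cyclic_order n)) = standard_cyclic_order n} =
    (\<lambda>j. rotation n j \<circ> reversal n) ` {1..n}" (is "?S = ?T")
proof (intro equalityI subsetI)
  fix \<sigma> assume "\<sigma> \<in> ?T"
  then show "\<sigma> \<in> ?S"
    using permutes_compose[OF reversal_permutes rotation_permutes]
    by (auto simp only: cyclic_relabel_comp cyclic_relabel_reversal[OF n] mem_Collect_eq
        cyclic_reverse_relabel[symmetric] cyclic_relabel_rotation[OF n] cyclic_reverse_reverse)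
next
  fix \<sigma> assume "\<sigma> \<in> ?S"
  then have \<sigma>: "\<sigma> permutes {1..n}"
    and stab: "cyclic_reverse (cyclic_relabel \<sigma> (standard_cyclic_order n)) = standard_cyclic_order n"
    by auto
  have "\<sigma> \<circ> reversal n \<in> rotation n ` {1..n}"
    unfolding stabilizer_standard_cyclic_order[OF n, symmetric]
    using permutes_compose[OF reversal_permutes \<sigma>] stab
    by (simp only: cyclic_relabel_comp cyclic_relabel_reversal[OF n] mem_Collect_eq
        cyclic_reverse_relabel[symmetric] simp_thms)
  then obtain j where j: "j \<in> {1..n}" "\<sigma> \<circ> reversal n = rotation n j" by auto
  have "\<sigma> = \<sigma> \<circ> reversal n \<circ> reversal n" by (simp add: comp_assoc reversal_reversal)
  then show "\<sigma> \<in> ?T" using j by auto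
qed

text \<open>The value is the representative in 1, ..., n of j + 1 - x modulo n.\<close>

lemma rotation_reversal_eq:
  assumes "x \<in> {1..n}" "j \<in> {1..n}"
  shows "(rotation n j \<circ> reversal n) x = (if j < x then Suc (n + j) - x else Suc j - x)"
proof -
  have r: "reversal n x = Suc (n - x)" "Suc (n - x) \<in> {1..n}"
    using assms by (auto simp: reversal_def)
  have "(rotation n j \<circ> reversal n) x = Suc ((n - x + j) mod n)"
    using r by (simp add: rotation_def)
  also have "(n - x + j) mod n = (if j < x then n - x + j else j - x)"
  proof (cases "j < x")
    case False
    then have "n - x + j = n + (j - x)" using assms by auto
    moreover have "j - x < n" using assms by auto
    ultimately show ?thesis using False by (simp only: mod_add_self1 mod_less if_False)
  qed (use assms in auto)
  finally show ?thesis using assms by auto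
qed

lemma inj_on_rotation_reversal: "inj_on (\<lambda>j. rotation n j \<circ> reversal n) {1..n}"
proof (rule inj_onI)
  fix i j assume ij: "i \<in> {1..n}" "j \<in> {1..n}"
    and eq: "rotation n i \<circ> reversal n = rotation n j \<circ> reversal n"
  then have "(rotation n i \<circ> reversal n) 1 = (rotation n j \<circ> reversal n) 1" by simp
  then show "i = j" using ij rotation_reversal_eq[of 1 n i] rotation_reversal_eq[of 1 n j] by auto
qed

text \<open>A reflection is an involution whose fixed points solve 2x = j + 1 or 2x = n + j + 1. For
  odd \<open>n\<close> exactly one right-hand side is even; for even \<open>n\<close> both are even
  or both are odd, according to whether \<open>j\<close> is odd or even.\<close>

lemma cycle_monomial_rotation_reversal:
  assumes j: "j \<in> {1..n}"
  shows "cycle_monomial n (rotation n j \<circ> reversal n) =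
    (if odd n then power_sum 2 ^ (n div 2) * power_sum 1
     else if odd j then power_sum 2 ^ (n div 2 - 1) * power_sum 1 ^ 2
     else power_sum 2 ^ (n div 2))"
proof -
  let ?f = "rotation n j \<circ> reversal n"
  let ?F = "{x \<in> {1..n}. ?f x = x}"
  have "?f (?f x) = x" if x: "x \<in> {1..n}" for x
  proof -
    \<comment> \<open>The image stays in range, so the explicit formula may be applied a second
      time.\<close>
    have "(if j < x then Suc (n + j) - x else Suc j - x) \<in> {1..n}" using x j by auto
    then show ?thesis
      using rotation_reversal_eq[OF x j] rotation_reversal_eq[OF _ j, of "?f x"] x j by auto
  qed
  with permutes_compose[OF reversal_permutes rotation_permutes]
  have mono: "cycle_monomial n ?f = power_sum 1 ^ card ?F * power_sum 2 ^ ((n - card ?F) div 2)"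
    by (rule cycle_monomial_involution)
  have F: "?F = {x \<in> {1..n}. 2 * x = Suc j \<or> 2 * x = Suc (n + j)}"
  proof (rule Collect_cong, rule conj_cong[OF refl])
    fix x assume x: "x \<in> {1..n}"
    show "?f x = x \<longleftrightarrow> 2 * x = Suc j \<or> 2 * x = Suc (n + j)"
      unfolding rotation_reversal_eq[OF x j] using x j by auto
  qed
  consider "odd n" | "even n" "odd j" | "even n" "even j" by blast
  then show ?thesis
  proof cases
    case 1
    have "?F = {if odd j then Suc j div 2 else Suc (n + j) div 2}"
      unfolding F using j 1 by (auto elim!: oddE evenE; presburger)
    then have "card ?F = 1" by simp
    moreover have "(n - 1) div 2 = n div 2" using 1 by (auto elim!: oddE)
    ultimately show ?thesis using 1 mono by (simp only: power_one_right mult.commute simp_thms if_True)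
  next
    case 2
    have "?F = {Suc j div 2, Suc (n + j) div 2}"
      unfolding F using j 2 by (auto elim!: oddE evenE; presburger)
    moreover have "Suc j div 2 \<noteq> Suc (n + j) div 2" using j 2 by (auto elim!: oddE evenE)
    ultimately have "card ?F = 2" by simp
    moreover have "(n - 2) div 2 = n div 2 - 1" by simp
    ultimately show ?thesis using 2 mono by (simp only: mult.commute simp_thms if_True if_False)
  next
    case 3
    have "?F = {}" unfolding F using 3 by (auto elim!: evenE; presburger)
    then have "card ?F = 0" by (simp only: card.empty)
    then show ?thesis using 3 mono by (simp only: power_0 mult_1_left minus_nat.diff_0 simp_thms if_False)
  qed
qed

section \<open>The cycle index of cyclic orders\<close>

context
  fixes n :: nat and g :: "nat \<Rightarrow> nat"
  assumes n: "n > 0" and g: "g \<in> carrier (sym_group 2)"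
begin

text \<open>The stabiliser consists of \<open>n\<close> distinct rotations, whence the factor
  1/n.\<close>

lemma cycle_index_term_cyclic_orders:
  "cycle_index_term cyclic_orders cyclic_transport cyclic_action g n =
    mps_const (1 / of_nat n) *
      (\<Sum>\<sigma> | \<sigma> permutes {1..n} \<and> cyclic_action g {1..n}
          (cyclic_relabel \<sigma> (standard_cyclic_order n)) = standard_cyclic_order n. cycle_monomial n \<sigma>)"
  using gamma_species.cycle_index_term_transitive[OF cyclic_orders_gamma_species
      standard_cyclic_order_in[OF n] _ g] cyclic_orders_transitive n
  by (simp add: cyclic_transport_def stabilizer_standard_cyclic_order[OF n]
      card_image[OF inj_on_rotation] del: One_nat_def)

lemma cyclic_action_relabel_standard:
  assumes "\<sigma> permutes {1..n}"
  shows "cyclic_action g {1..n} (cyclic_relabel \<sigma> (standard_cyclic_order n)) =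
    (if g = \<one>\<^bsub>sym_group 2\<^esub> then cyclic_relabel \<sigma> (standard_cyclic_order n)
     else cyclic_reverse (cyclic_relabel \<sigma> (standard_cyclic_order n)))"
  using cyclic_relabel_in[OF permutes_imp_bij[OF assms] standard_cyclic_order_in[OF n]]
  by (simp add: cyclic_action_def)

lemma cycle_index_term_cyclic_orders_one:
  assumes "g = \<one>\<^bsub>sym_group 2\<^esub>"
  shows "cycle_index_term cyclic_orders cyclic_transport cyclic_action g n =
    (\<Sum>k | k dvd n. mps_const (of_nat (totient k) / of_nat n) * power_sum k ^ (n div k))"
proof -
  have "{\<sigma>. \<sigma> permutes {1..n} \<and> cyclic_action g {1..n}
        (cyclic_relabel \<sigma> (standard_cyclic_order n)) = standard_cyclic_order n} = rotation n ` {1..n}"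
    unfolding stabilizer_standard_cyclic_order[OF n, symmetric]
    using assms cyclic_action_relabel_standard by auto
  then have "cycle_index_term cyclic_orders cyclic_transport cyclic_action g n =
      mps_const (1 / of_nat n) * (\<Sum>j\<in>{1..n}. cycle_monomial n (rotation n j))"
    unfolding cycle_index_term_cyclic_orders by (simp only: sum.reindex[OF inj_on_rotation] o_def)
  also have "(\<Sum>j\<in>{1..n}. cycle_monomial n (rotation n j)) =
      (\<Sum>j\<in>{1..n}. power_sum (n div gcd j n) ^ (n div (n div gcd j n)))"
    by (simp only: cycle_monomial_rotation[OF n])
  \<comment> \<open>Rotations are grouped by their common cycle length \<open>k\<close>; those of
    length \<open>k\<close> are the \<open>j\<close> with gcd(j, n) = n/k, and there are \<phi>(k)
    of them.\<close>
  also have "\<dots> = (\<Sum>k | k dvd n. \<Sum>j | j \<in> {1..n} \<and> n div gcd j n = k.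
      power_sum (n div gcd j n) ^ (n div (n div gcd j n)))"
    using n by (intro sum.group[symmetric]) (auto, metis dvd_div_mult_self dvd_triv_left gcd_dvd2)
  also have "\<dots> = (\<Sum>k | k dvd n. mps_const (of_nat (totient k)) * power_sum k ^ (n div k))"
  proof (rule sum.cong[OF refl])
    fix k assume "k \<in> {k. k dvd n}"
    then have k: "k dvd n" by simp
    then have k': "n div k dvd n" "n div (n div k) = k"
      using n by (auto elim!: dvdE)
    have "n div gcd j n = k \<longleftrightarrow> gcd j n = n div k" for j
    proof
      assume "n div gcd j n = k"
      then have "n = k * gcd j n" by auto
      then show "gcd j n = n div k" using n by (metis nonzero_mult_div_cancel_left mult_eq_0_iff not_gr_zero)
    qed (use k' in simp)
    then have "{j. j \<in> {1..n} \<and> n div gcd j n = k} = {j \<in> {0<..n}. gcd j n = n div k}" by auto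
    then have card: "card {j. j \<in> {1..n} \<and> n div gcd j n = k} = totient k"
      using card_gcd_eq_totient[OF n k'(1)] k'(2) by simp
    have "(\<Sum>j | j \<in> {1..n} \<and> n div gcd j n = k.
        power_sum (n div gcd j n) ^ (n div (n div gcd j n))) =
        (\<Sum>j | j \<in> {1..n} \<and> n div gcd j n = k. power_sum k ^ (n div k))"
      by (rule sum.cong) auto
    also have "\<dots> = mps_const (of_nat (totient k)) * power_sum k ^ (n div k)"
      by (simp only: sum_constant card mps_const_of_nat)
    finally show "(\<Sum>j | j \<in> {1..n} \<and> n div gcd j n = k.
        power_sum (n div gcd j n) ^ (n div (n div gcd j n))) =
        mps_const (of_nat (totient k)) * power_sum k ^ (n div k)" .
  qed
  finally show ?thesis
    by (auto intro!: mps_eqI simp: sum_distrib_left)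
qed

lemma cycle_index_term_cyclic_orders_reverse:
  assumes "g \<noteq> \<one>\<^bsub>sym_group 2\<^esub>"
  shows "cycle_index_term cyclic_orders cyclic_transport cyclic_action g n =
    mps_const (1 / of_nat n) * (\<Sum>j=1..n. if odd n then power_sum 2 ^ (n div 2) * power_sum 1
     else if odd j then power_sum 2 ^ (n div 2 - 1) * power_sum 1 ^ 2
     else power_sum 2 ^ (n div 2))"
proof -
  have "{\<sigma>. \<sigma> permutes {1..n} \<and> cyclic_action g {1..n}
        (cyclic_relabel \<sigma> (standard_cyclic_order n)) = standard_cyclic_order n} =
      (\<lambda>j. rotation n j \<circ> reversal n) ` {1..n}"
    unfolding reverse_stabilizer_standard_cyclic_order[OF n, symmetric]
    using assms cyclic_action_relabel_standard by auto
  then have "cycle_index_term cyclic_orders cyclic_transport cyclic_action g n =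
      mps_const (1 / of_nat n) * (\<Sum>j\<in>{1..n}. cycle_monomial n (rotation n j \<circ> reversal n))"
    unfolding cycle_index_term_cyclic_orders
    by (simp only: sum.reindex[OF inj_on_rotation_reversal] o_def[of "cycle_monomial n"])
  then show ?thesis
    by (simp only: cycle_monomial_rotation_reversal cong: sum.cong)
qed

end

text \<open>There is no structure on the empty set, so every fixed-point count in degree zero
  vanishes.\<close>

lemma cycle_index_term_cyclic_orders_0:
  "cycle_index_term cyclic_orders cyclic_transport cyclic_action g 0 = 0"
proof -
  have "mps_const 0 = (0 :: rat mps)" by (simp add: mps_const_def zero_mps_def)
  then show ?thesis by (simp add: cycle_index_term_def fix_count_def cyclic_orders_empty)
qed

lemma sum_alternating_parity:
  fixes a b :: "'a::comm_ring_1"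
  shows "(\<Sum>j=1..2 * k. if odd j then a else b) = of_nat k * (a + b)"
  by (induction k) (auto simp: algebra_simps)

lemma cycle_index_term_cyclic_orders_reverse_odd:
  assumes "g \<in> carrier (sym_group 2)" "g \<noteq> \<one>\<^bsub>sym_group 2\<^esub>"
  shows "cycle_index_term cyclic_orders cyclic_transport cyclic_action g (Suc (2 * k)) =
    power_sum 2 ^ k * power_sum 1"
proof -
  have "cycle_index_term cyclic_orders cyclic_transport cyclic_action g (Suc (2 * k)) =
      mps_const (1 / of_nat (Suc (2 * k))) * (of_nat (Suc (2 * k)) * (power_sum 2 ^ k * power_sum 1))"
    using cycle_index_term_cyclic_orders_reverse[OF _ assms, of "Suc (2 * k)"] by simp
  then show ?thesis
    by (intro mps_eqI) (simp add: mps_const_of_nat[symmetric] del: of_nat_Suc)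
qed

text \<open>Half of the 2(k+1) reflections have each cycle type, so each monomial gets the weight
  (k+1)/(2(k+1)) = 1/2.\<close>

lemma cycle_index_term_cyclic_orders_reverse_even:
  assumes "g \<in> carrier (sym_group 2)" "g \<noteq> \<one>\<^bsub>sym_group 2\<^esub>"
  shows "cycle_index_term cyclic_orders cyclic_transport cyclic_action g (2 * Suc k) =
    mps_const (1 / 2) * (power_sum 2 ^ Suc k + power_sum 2 ^ k * power_sum 1 ^ 2)"
    (is "_ = mps_const (1 / 2) * (?a + ?b)")
proof -
  have "cycle_index_term cyclic_orders cyclic_transport cyclic_action g (2 * Suc k) =
      mps_const (1 / of_nat (2 * Suc k)) * (\<Sum>j=1..2 * Suc k. if odd j then ?b else ?a)"
    using cycle_index_term_cyclic_orders_reverse[OF _ assms, of "2 * Suc k"]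
    by (simp only: dvd_triv_left simp_thms if_False nonzero_mult_div_cancel_left diff_Suc_1) simp
  also have "\<dots> = mps_const (1 / of_nat (2 * Suc k)) * (mps_const (of_nat (Suc k)) * (?b + ?a))"
    by (simp only: sum_alternating_parity mps_const_of_nat)
  also have "\<dots> = mps_const (1 / 2) * (?a + ?b)"
    by (rule mps_eqI) (simp only: mps_nth_const_mult add.commute, simp add: field_simps)
  finally show ?thesis .
qed

section \<open>Comparison of coefficients with the stated series\<close>

lemma sums_cycle_index_cyclic_orders_one:
  "(\<lambda>k. mps_const (of_nat (totient (Suc k)) / of_nat (Suc k)) *
        fps_subst fps_ln_inverse_1_minus_X (power_sum (Suc k)))
     sums gamma_cycle_index cyclic_orders cyclic_transport cyclic_action \<one>\<^bsub>sym_group 2\<^esub>"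
  unfolding sums_def tendsto_mps_iff
proof
  fix m
  let ?e = "\<one>\<^bsub>sym_group 2\<^esub>" and ?d = "mon_deg m"
  \<comment> \<open>The common contribution of \<open>k\<close> on both sides: on the logarithmic
    side it arises as \<phi>(k)/k times k/d.\<close>
  let ?c = "\<lambda>k. of_nat (totient k) / of_nat ?d * mps_nth (power_sum k ^ (?d div k)) m"
  have e: "?e \<in> carrier (sym_group 2)"
    using group.is_monoid[OF sym_group_is_group] by (rule monoid.one_closed)
  \<comment> \<open>For degree zero every \<open>k\<close> divides \<open>?d\<close>; the bound
    leaves only \<open>k = 0\<close>, whose summand is zero by division by zero.\<close>
  have lhs: "mps_nth (gamma_cycle_index cyclic_orders cyclic_transport cyclic_action ?e) m =
      (\<Sum>k | k dvd ?d \<and> k \<le> ?d. ?c k)"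
  proof (cases "?d = 0")
    case True
    then show ?thesis unfolding gamma_cycle_index_def
        mps_nth_suminf_homogeneous[OF mps_homogeneous_cycle_index_term]
      by (simp add: cycle_index_term_cyclic_orders_0)
  next
    case False
    then have "{k. k dvd ?d} = {k. k dvd ?d \<and> k \<le> ?d}" by (auto dest: dvd_imp_le)
    with False show ?thesis unfolding gamma_cycle_index_def
        mps_nth_suminf_homogeneous[OF mps_homogeneous_cycle_index_term]
      by (simp add: cycle_index_term_cyclic_orders_one[OF _ e refl])
  qed
  show "\<forall>\<^sub>F N in sequentially.
      mps_nth (\<Sum>k<N. mps_const (of_nat (totient (Suc k)) / of_nat (Suc k)) *
        fps_subst fps_ln_inverse_1_minus_X (power_sum (Suc k))) m =
      mps_nth (gamma_cycle_index cyclic_orders cyclic_transport cyclic_action ?e) m"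
  \<comment> \<open>From \<open>N = ?d\<close> on, the shifted indices 1, ..., N include every
    divisor of a positive degree.\<close>
  proof (rule eventually_sequentiallyI)
    fix N assume N: "?d \<le> N"
    have "mps_nth (\<Sum>k<N. mps_const (of_nat (totient (Suc k)) / of_nat (Suc k)) *
        fps_subst fps_ln_inverse_1_minus_X (power_sum (Suc k))) m =
        (\<Sum>k<N. if Suc k dvd ?d then ?c (Suc k) else 0)"
      unfolding mps_nth_sum mps_nth_const_mult
      by (rule sum.cong) (auto simp: mps_nth_fps_subst_ln_power_sum simp del: of_nat_Suc)
    also have "\<dots> = (\<Sum>k\<in>Suc ` {..<N}. if k dvd ?d then ?c k else 0)"
      by (simp add: sum.reindex)
    also have "\<dots> = (\<Sum>k | k dvd ?d \<and> k \<le> ?d. ?c k)"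
    proof (cases "?d = 0")
      case True
      then show ?thesis by simp
    next
      case False
      then have "{k. k dvd ?d \<and> k \<le> ?d} = {k \<in> {1..N}. k dvd ?d}"
        using N by (auto simp: Suc_le_eq intro: dvd_imp_le Nat.gr0I)
      then show ?thesis by (simp only: sum.inter_filter[OF finite_atLeastAtMost] image_Suc_lessThan)
    qed
    finally show "mps_nth (\<Sum>k<N. mps_const (of_nat (totient (Suc k)) / of_nat (Suc k)) *
        fps_subst fps_ln_inverse_1_minus_X (power_sum (Suc k))) m =
        mps_nth (gamma_cycle_index cyclic_orders cyclic_transport cyclic_action ?e) m"
      unfolding lhs .
  qed
qed

lemma mps_homogeneous_even_part:
  "mps_homogeneous (2 * Suc k) (mps_const (1 / 2) *
     (power_sum 2 ^ Suc k + power_sum 2 ^ k * power_sum 1 ^ 2))"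
proof (intro mps_homogeneous_const_mult mps_homogeneous_add)
  show "mps_homogeneous (2 * Suc k) (power_sum 2 ^ Suc k)"
    using mps_homogeneous_power[OF mps_homogeneous_power_sum[of 2], of "Suc k"]
    by (simp only: mult.commute)
  show "mps_homogeneous (2 * Suc k) (power_sum 2 ^ k * power_sum 1 ^ 2)"
    using mps_homogeneous_mult[OF mps_homogeneous_power[OF mps_homogeneous_power_sum[of 2], of k]
        mps_homogeneous_power[OF mps_homogeneous_power_sum[of 1], of 2]]
    by (simp add: mult.commute)
qed

lemma mps_homogeneous_odd_part: "mps_homogeneous (Suc (2 * k)) (power_sum 2 ^ k * power_sum 1)"
  using mps_homogeneous_mult[OF mps_homogeneous_power[OF mps_homogeneous_power_sum[of 2], of k]
      mps_homogeneous_power_sum[of 1]]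
  by (simp add: mult.commute)

lemma mps_ord_ge_homogeneous: "mps_homogeneous d f \<Longrightarrow> e \<le> d \<Longrightarrow> mps_ord_ge e f"
  by (rule mps_ord_ge_mono[OF mps_homogeneous_imp_ord_ge])

text \<open>Injectivity of the degrees leaves at most one term that meets \<open>m\<close>, and
  \<open>k \<le> d k\<close> ensures that its index is among those summed. It is applied with the
  degrees 2k + 2 and 2k + 1.\<close>

lemma mps_nth_suminf_graded:
  assumes hom: "\<And>k. mps_homogeneous (d k) (f k)" and d: "\<And>k. k \<le> d k" "inj d"
  shows "mps_nth (suminf f) m = (if mon_deg m \<in> range d then mps_nth (f (inv_into UNIV d (mon_deg m))) m else 0)"
proof -
  have "mps_nth (suminf f) m = (\<Sum>k\<le>mon_deg m. mps_nth (f k) m)"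
    using mps_ord_ge_homogeneous[OF hom d(1)] by (rule mps_nth_suminf)
  also have "\<dots> = (\<Sum>k\<le>mon_deg m. if d k = mon_deg m then mps_nth (f k) m else 0)"
  proof (rule sum.cong[OF refl])
    fix k
    show "mps_nth (f k) m = (if d k = mon_deg m then mps_nth (f k) m else 0)"
      using hom[of k] by (auto simp: mps_homogeneous_def)
  qed
  also have "\<dots> = (if mon_deg m \<in> range d then mps_nth (f (inv_into UNIV d (mon_deg m))) m else 0)"
  proof (cases "mon_deg m \<in> range d")
    case True
    then obtain l where l: "mon_deg m = d l" by blast
    then show ?thesis using d by (simp add: inj_eq)
  next
    case False
    then have "d k \<noteq> mon_deg m" for k by (metis rangeI)
    then show ?thesis using False by simp
  qed
  finally show ?thesis .
qed

lemma cycle_index_cyclic_orders_reverse: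
  assumes \<tau>: "\<tau> \<in> carrier (sym_group 2)" "\<tau> \<noteq> \<one>\<^bsub>sym_group 2\<^esub>"
  shows "gamma_cycle_index cyclic_orders cyclic_transport cyclic_action \<tau> =
    suminf (\<lambda>k. mps_const (1 / 2) * (power_sum 2 ^ Suc k + power_sum 2 ^ k * power_sum 1 ^ 2)) +
    suminf (\<lambda>k. power_sum 2 ^ k * power_sum 1)" (is "_ = suminf ?E + suminf ?O")
proof (rule mps_eqI)
  fix m
  let ?d = "mon_deg m"
  have Z: "mps_nth (gamma_cycle_index cyclic_orders cyclic_transport cyclic_action \<tau>) m =
      mps_nth (cycle_index_term cyclic_orders cyclic_transport cyclic_action \<tau> ?d) m"
    unfolding gamma_cycle_index_def
    by (rule mps_nth_suminf_homogeneous[OF mps_homogeneous_cycle_index_term])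
  have injs: "inj (\<lambda>k. 2 * Suc k)" "inj (\<lambda>k. Suc (2 * k))" by (auto intro!: injI)
  note E = mps_nth_suminf_graded[OF mps_homogeneous_even_part _ injs(1), of m]
  note O = mps_nth_suminf_graded[OF mps_homogeneous_odd_part _ injs(2), of m]
  \<comment> \<open>The two series live in the positive even and the odd degrees respectively, so in
    each degree at most one of them contributes.\<close>
  consider "?d = 0" | k where "?d = Suc (2 * k)" | k where "?d = 2 * Suc k"
    by (metis evenE oddE Suc_eq_plus1 not0_implies_Suc mult_0_right)
  then show "mps_nth (gamma_cycle_index cyclic_orders cyclic_transport cyclic_action \<tau>) m =
      mps_nth (suminf ?E + suminf ?O) m"
  proof cases
    case 1
    then have "?d \<notin> range (\<lambda>k. 2 * Suc k)" "?d \<notin> range (\<lambda>k. Suc (2 * k))" by auto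
    then show ?thesis using E O 1 by (simp add: Z cycle_index_term_cyclic_orders_0)
  next
    case (2 k)
    then have r: "?d \<notin> range (\<lambda>k. 2 * Suc k)" "?d \<in> range (\<lambda>k. Suc (2 * k))" by (auto, presburger)
    have "inv_into UNIV (\<lambda>k. Suc (2 * k)) ?d = k" unfolding 2 by (rule inv_f_f[OF injs(2)])
    then show ?thesis
      using E O r cycle_index_term_cyclic_orders_reverse_odd[OF \<tau>, of k] 2 by (simp add: Z)
  next
    case (3 k)
    then have r: "?d \<in> range (\<lambda>k. 2 * Suc k)" "?d \<notin> range (\<lambda>k. Suc (2 * k))" by (auto, presburger)
    have "inv_into UNIV (\<lambda>k. 2 * Suc k) ?d = k" unfolding 3 by (rule inv_f_f[OF injs(1)])
    then show ?thesis
      using E O r cycle_index_term_cyclic_orders_reverse_even[OF \<tau>, of k] 3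
      by (simp only: Z mps_nth_add) simp
  qed
qed

text \<open>Sums from k = 1 are shifted to start at 0. The summability claims give content to the
  two \<open>suminf\<close> terms, whose value is unspecified for divergent series.\<close>

theorem theorem6p2:
  fixes \<tau> :: "nat \<Rightarrow> nat"
  assumes "\<tau> \<in> carrier (sym_group 2)" and "\<tau> \<noteq> \<one>\<^bsub>sym_group 2\<^esub>"
  shows
    "(\<lambda>k. mps_const (of_nat (totient (Suc k)) / of_nat (Suc k)) *
           fps_subst fps_ln_inverse_1_minus_X (power_sum (Suc k)))
       sums gamma_cycle_index cyclic_orders cyclic_transport cyclic_action \<one>\<^bsub>sym_group 2\<^esub>
     \<and> summable (\<lambda>k. mps_const (1 / 2) *
           (power_sum 2 ^ Suc k + power_sum 2 ^ k * power_sum 1 ^ 2))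
     \<and> summable (\<lambda>k. power_sum 2 ^ k * power_sum 1)
     \<and> gamma_cycle_index cyclic_orders cyclic_transport cyclic_action \<tau> =
         suminf (\<lambda>k. mps_const (1 / 2) *
           (power_sum 2 ^ Suc k + power_sum 2 ^ k * power_sum 1 ^ 2))
         + suminf (\<lambda>k. power_sum 2 ^ k * power_sum 1)"
proof (intro conjI)
  show "summable (\<lambda>k. mps_const (1 / 2) *
      (power_sum 2 ^ Suc k + power_sum 2 ^ k * power_sum 1 ^ 2))"
    by (intro mps_summable mps_ord_ge_homogeneous[OF mps_homogeneous_even_part]) simp
  show "summable (\<lambda>k. power_sum 2 ^ k * power_sum 1)"
    by (intro mps_summable mps_ord_ge_homogeneous[OF mps_homogeneous_odd_part]) simp
qed (rule sums_cycle_index_cyclic_orders_one cycle_index_cyclic_orders_reverse[OF assms])+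

end
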